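(* Let $\mathbb{F}$ be a field, $n\ge1$, and let $\mathcal{F},\mathcal{F}'$ be two flags in $\mathbb{F}^n$ of the same length $r>2$. Put $S=\varphi(\mathcal{F})$ and $T=\varphi(\mathcal{F}')$. (1) If $\mathbb{F}$ is infinite and $\mathrm{sig}(\mathcal{F})=(k,1,l)$ with $k,l>1$, then $S\cong T$ if and only if $\mathrm{sig}(\mathcal{F}')=(k',1,l')$ for some $k',l'>1$. (2) If $\mathbb{F}$ is infinite and $\mathrm{sig}(\mathcal{F})$ is not of the form $(k,1,l)$ with $k,l>1$, then $S\cong T$ if and only if $\mathrm{sig}(\mathcal{F})=\mathrm{sig}(\mathcal{F}')$. (3) If $\mathbb{F}$ is finite, then $S\cong T$ if and only if $\mathrm{sig}(\mathcal{F})=\mathrm{sig}(\mathcal{F}')$.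
   Context: $M(n,\mathbb{F})$ is the semigroup of $n\times n$ matrices over $\mathbb{F}$, identified with linear operators on $\mathbb{F}^n$. A flag in $\mathbb{F}^n$ of length $k$ is a chain $\mathcal{F}: 0=V_0\subsetneq V_1\subsetneq\cdots\subsetneq V_k=\mathbb{F}^n$ of subspaces; its signature is $\mathrm{sig}(\mathcal{F})=(d_1,\dots,d_k)$ with $d_i=\dim(V_i/V_{i-1})$. $\varphi(\mathcal{F})=\{a\in M(n,\mathbb{F}) : a(V_i)\subseteq V_{i-1}\text{ for all } i=1,\dots,k\}$. $\cong$ denotes isomorphism of semigroups. *)

theory Defs
  imports "HOL-Analysis.Analysis"
begin

text \<open>A flag \<open>0 = V_0 \<subset> V_1 \<subset> ... \<subset> V_k = F^n\<close> is represented by the list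
  \<open>[V_0, ..., V_k]\<close> of subspaces of \<open>F^n\<close> (here \<open>'a^'n\<close>, with \<open>n = CARD('n)\<close>).\<close>

definition is_flag :: "('a::field ^ 'n) set list \<Rightarrow> bool" where
  "is_flag Vs \<longleftrightarrow> Vs \<noteq> [] \<and> hd Vs = {0} \<and> last Vs = UNIV \<and>
     (\<forall>V\<in>set Vs. vec.subspace V) \<and>
     (\<forall>i. Suc i < length Vs \<longrightarrow> Vs ! i \<subset> Vs ! Suc i)"

definition flag_length :: "('a::field ^ 'n) set list \<Rightarrow> nat" where
  "flag_length Vs = length Vs - 1"

text \<open>Signature: \<open>d_i = dim(V_i / V_{i-1}) = dim V_i - dim V_{i-1}\<close>.\<close>
definition flag_sig :: "('a::field ^ 'n) set list \<Rightarrow> nat list" where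
  "flag_sig Vs = map (\<lambda>i. vec.dim (Vs ! Suc i) - vec.dim (Vs ! i)) [0..<length Vs - 1]"

definition flag_phi :: "('a::field ^ 'n) set list \<Rightarrow> ('a ^ 'n ^ 'n) set" where
  "flag_phi Vs = {a. \<forall>i. Suc i < length Vs \<longrightarrow> (\<lambda>x. a *v x) ` (Vs ! Suc i) \<subseteq> Vs ! i}"

definition semigroup_iso :: "('a::field ^ 'n ^ 'n) set \<Rightarrow> ('a ^ 'n ^ 'n) set \<Rightarrow> bool" where
  "semigroup_iso S T \<longleftrightarrow> (\<exists>f. bij_betw f S T \<and> (\<forall>a\<in>S. \<forall>b\<in>S. f (a ** b) = f a ** f b))"

end

theory Submission
  imports Defs "HOL-Library.Equipollence"
begin

text \<open>
  Write \<open>U = V_1\<close> and \<open>M = V_{r-1}\<close>. The ideals \<open>L = {a. S a = 0}\<close> (matrices with range in \<open>U\<close>) and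
  \<open>R = {a. a S = 0}\<close> (matrices vanishing on \<open>M\<close>) are determined by the multiplication. The annihilators in \<open>R\<close> of subsets of \<open>L\<close> form
  the lattice of subspaces between \<open>U\<close> and \<open>M\<close>, and the matrices with range in \<open>V_i\<close> are those
  killed by \<open>S^i\<close> from the left, so \<open>dim V_i - dim U\<close> is an invariant for \<open>1 \<le> i < r\<close>. Inclusion
  of right ideals \<open>a R \<subseteq> b R\<close> orders \<open>L\<close> like the subspaces of \<open>U\<close> of dimension at most
  \<open>dim M / U\<close>; if this bound is at least 2, it recovers the lattice of all subspaces of \<open>U\<close>, hence
  \<open>dim U\<close>. Over a finite field \<open>dim U\<close> is found by counting.

  If \<open>dim M / U = 1\<close> the signature is \<open>(k, 1, l)\<close> and \<open>a b\<close> is the outer product of \<open>a w \<in> U\<close>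
  with a functional of \<open>b\<close>, where \<open>w\<close> spans \<open>M\<close> modulo \<open>U\<close>. Then \<open>k = 1\<close> and \<open>l = 1\<close> are still
  visible, but for \<open>k, l > 1\<close> over an infinite field only the cardinality of the projective spaces
  matters: homogeneous bijections of the column and row parts preserve equality of outer products,
  and every fibre contains equally many elements that are not products.
\<close>

section \<open>Matrices of rank one and subspaces\<close>

definition outer :: "'a::field ^ 'n \<Rightarrow> 'a ^ 'n \<Rightarrow> 'a ^ 'n ^ 'n" where
  "outer u y = (\<chi> i j. u $ i * y $ j)"

text \<open>The standard pairing, through which a vector \<open>y\<close> also serves as a linear
  functional over an arbitrary field.\<close>

definition dotp :: "'a::field ^ 'n \<Rightarrow> 'a ^ 'n \<Rightarrow> 'a" where
  "dotp y x = (\<Sum>i\<in>UNIV. y $ i * x $ i)"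

lemma outer_mult_vec: "outer u y *v x = dotp y x *s u"
  by (simp add: outer_def dotp_def matrix_vector_mult_def vec_eq_iff sum_distrib_left ac_simps)

lemma mult_outer: "a ** outer u y = outer (a *v u) y"
  by (simp add: outer_def matrix_matrix_mult_def matrix_vector_mult_def vec_eq_iff
      sum_distrib_left ac_simps)

lemma matrix_eqI:
  fixes a b :: "'a::field ^ 'n ^ 'm"
  shows "(\<And>x. a *v x = b *v x) \<Longrightarrow> a = b"
  by (simp add: matrix_eq)

lemma dotp_zero_left [simp]: "dotp 0 x = 0" and dotp_zero_right [simp]: "dotp y 0 = 0"
  by (simp_all add: dotp_def)

lemma dotp_add_right: "dotp y (x + x') = dotp y x + dotp y x'"
  by (simp add: dotp_def sum.distrib algebra_simps)

lemma dotp_add_left: "dotp (y + y') x = dotp y x + dotp y' x"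
  by (simp add: dotp_def sum.distrib algebra_simps)

lemma dotp_scale_right: "dotp y (c *s x) = c * dotp y x"
  by (simp add: dotp_def sum_distrib_left ac_simps)

lemma dotp_scale_left: "dotp (c *s y) x = c * dotp y x"
  by (simp add: dotp_def sum_distrib_left ac_simps)

lemma dotp_axis: "dotp y (axis i 1) = y $ i"
  by (simp add: dotp_def axis_def if_distrib [of "\<lambda>z. _ * z"] cong: if_cong)

lemma dotp_eqI: "(\<And>x. dotp y x = dotp z x) \<Longrightarrow> y = z"
  by (metis dotp_axis vec_eq_iff)

lemma linear_extension_matrix:
  fixes B :: "('a::field ^ 'n) set" and h :: "'a ^ 'n \<Rightarrow> 'a ^ 'm"
  assumes "vec.independent B"
  obtains A where "\<And>b. b \<in> B \<Longrightarrow> A *v b = h b"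
proof -
  obtain g where "Vector_Spaces.linear (*s) (*s) g" "\<forall>b\<in>B. g b = h b"
    using vec.linear_independent_extend [OF assms] by blast
  then show thesis
    using that [of "matrix g"] by (simp add: matrix_works)
qed

lemma matrix_eq_on_span:
  fixes a b :: "'a::field ^ 'n ^ 'm"
  assumes "\<And>x. x \<in> B \<Longrightarrow> a *v x = b *v x" and "x \<in> vec.span B"
  shows "a *v x = b *v x"
  using assms(2)
  by (induction rule: vec.span_induct_alt)
    (simp_all add: assms(1) matrix_vector_right_distrib vec.scale)

text \<open>Extend a basis of \<open>W\<close> by \<open>x\<close> and let a matrix kill
  \<open>W\<close> and fix \<open>x\<close>. A row at a coordinate where \<open>x\<close> is
  nonzero, rescaled, is the functional.\<close>

lemma separating_functional:
  fixes W :: "('a::field ^ 'n) set"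
  assumes "vec.subspace W" "x \<notin> W"
  obtains y where "\<And>w. w \<in> W \<Longrightarrow> dotp y w = 0" "dotp y x = 1"
proof -
  obtain B where B: "B \<subseteq> W" "vec.independent B" "vec.span B = W"
    using vec.basis_subspace_exists [OF assms(1)] by metis
  have "vec.independent (insert x B)"
    using B assms(2) by (simp add: vec.independent_insertI)
  then obtain A :: "'a ^ 'n ^ 'n" where A: "\<And>b. b \<in> insert x B \<Longrightarrow> A *v b = (if b = x then x else 0)"
    using linear_extension_matrix [of "insert x B" "\<lambda>b. if b = x then x else 0"] by blast
  have AW: "A *v w = 0" if "w \<in> W" for w
    using matrix_eq_on_span [of B A 0 w] A B assms(2) that by force
  have "x \<noteq> 0"
    using assms vec.subspace_0 by blast
  then obtain i where i: "x $ i \<noteq> 0"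
    by (metis vec_eq_iff zero_index)
  have "dotp (A $ i) w = (A *v w) $ i" for w
    by (simp add: dotp_def matrix_vector_mult_def)
  then show thesis
    using that [of "inverse (x $ i) *s (A $ i)"] AW A [of x] i
    by (simp add: dotp_scale_left)
qed

lemma subspace_range:
  fixes a :: "'a::field ^ 'n ^ 'n"
  assumes "vec.subspace W"
  shows "vec.subspace ((*v) a ` W)"
  using vec.subspace_image assms by blast

lemma dim_span_insert:
  fixes W :: "('a::field ^ 'n) set"
  assumes "vec.subspace W" "x \<notin> W"
  shows "vec.dim (vec.span (insert x W)) = Suc (vec.dim W)"
  using assms vec.dim_insert [of x W] by (metis Suc_eq_plus1 vec.dim_span vec.span_eq_iff)

text \<open>Adding one vector at a time gives a chain from \<open>A\<close> to \<open>B\<close> in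
  which every step raises \<open>vec.dim (\<phi> W)\<close> by at least one. This turns an embedding
  of lattices of subspaces into an inequality of dimensions; sums avoid subtraction on
  naturals.\<close>

lemma strict_mono_dim_le:
  fixes A B :: "('a::field ^ 'n) set" and \<phi> :: "('a ^ 'n) set \<Rightarrow> ('a ^ 'm) set"
  assumes "vec.subspace A" "vec.subspace B" "A \<subseteq> B"
    and "\<And>W. vec.subspace W \<Longrightarrow> A \<subseteq> W \<Longrightarrow> W \<subseteq> B \<Longrightarrow> vec.subspace (\<phi> W)"
    and "\<And>W W'. vec.subspace W \<Longrightarrow> vec.subspace W' \<Longrightarrow> A \<subseteq> W \<Longrightarrow> W \<subset> W' \<Longrightarrow> W' \<subseteq> B \<Longrightarrow> \<phi> W \<subset> \<phi> W'"
  shows "vec.dim B + vec.dim (\<phi> A) \<le> vec.dim (\<phi> B) + vec.dim A"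
  using assms
proof (induction "vec.dim B - vec.dim A" arbitrary: A rule: less_induct)
  case (less A)
  show ?case
  proof (cases "A = B")
    case False
    then obtain x where x: "x \<in> B" "x \<notin> A"
      using less.prems by blast
    define C where "C = vec.span (insert x A)"
    have C: "vec.subspace C" "A \<subset> C" "C \<subseteq> B"
      using less.prems x vec.span_superset [of "insert x A"]
      by (auto simp: C_def vec.span_minimal psubset_eq)
    have d: "vec.dim C = Suc (vec.dim A)"
      using dim_span_insert less.prems x C_def by blast
    moreover have "vec.dim C \<le> vec.dim B"
      using C vec.dim_subset by blast
    ultimately have "vec.dim B + vec.dim (\<phi> C) \<le> vec.dim (\<phi> B) + vec.dim C"
      using C less.prems by (intro less.hyps) auto
    moreover have "vec.dim (\<phi> A) < vec.dim (\<phi> C)"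
    proof (rule vec.dim_psubset)
      have "vec.subspace (\<phi> A)" "vec.subspace (\<phi> C)" "\<phi> A \<subset> \<phi> C"
        using less.prems C by auto
      then show "vec.span (\<phi> A) \<subset> vec.span (\<phi> C)"
        by (metis vec.span_eq_iff)
    qed
    ultimately show ?thesis
      using d by simp
  qed auto
qed

section \<open>The nilpotent semigroup of a flag\<close>

text \<open>For \<open>i > 0\<close> and \<open>S\<close> closed under products, these are the
  elements of \<open>S\<close> killed by all products of \<open>i\<close> factors from
  \<open>S\<close> on the left. Only products and \<open>0\<close> occur, so isomorphisms preserve
  the series.\<close>

primrec socle_series :: "('a::field ^ 'n ^ 'n) set \<Rightarrow> nat \<Rightarrow> ('a ^ 'n ^ 'n) set" where
  "socle_series S 0 = {0}"
| "socle_series S (Suc i) = {c \<in> S. \<forall>s\<in>S. s ** c \<in> socle_series S i}"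

definition left_annihilator :: "('a::field ^ 'n ^ 'n) set \<Rightarrow> ('a ^ 'n ^ 'n) set" where
  "left_annihilator S = {c \<in> S. \<forall>s\<in>S. c ** s = 0}"

text \<open>The flag is a function on all naturals that is constrained only up to the index
  \<open>r\<close>.\<close>

locale flag =
  fixes V :: "nat \<Rightarrow> ('a::field ^ 'n) set" and r :: nat
  assumes r_gt_2: "2 < r" and V_0: "V 0 = {0}" and V_r: "V r = UNIV"
    and subspace_V: "\<And>i. i \<le> r \<Longrightarrow> vec.subspace (V i)"
    and V_step: "\<And>i. i < r \<Longrightarrow> V i \<subset> V (Suc i)"
begin

definition S :: "('a ^ 'n ^ 'n) set" where
  "S = {a. \<forall>i<r. \<forall>x\<in>V (Suc i). a *v x \<in> V i}"

definition L :: "('a ^ 'n ^ 'n) set" where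
  "L = socle_series S 1"

definition R :: "('a ^ 'n ^ 'n) set" where
  "R = left_annihilator S"

definition U :: "('a ^ 'n) set" where "U = V 1"

definition M :: "('a ^ 'n) set" where "M = V (r - 1)"

lemma V_mono: "i \<le> j \<Longrightarrow> j \<le> r \<Longrightarrow> V i \<subseteq> V j"
proof (induction j)
  case (Suc j)
  then show ?case
    using V_step [of j] by (cases "i = Suc j") auto
qed simp

lemma zero_in_V [simp]: "i \<le> r \<Longrightarrow> 0 \<in> V i"
  using subspace_V vec.subspace_0 by blast

lemma subspace_U: "vec.subspace U" and subspace_M: "vec.subspace M"
  using subspace_V r_gt_2 by (auto simp: U_def M_def)

lemma U_psubset_M: "U \<subset> M"
proof -
  have "V (Suc 1) \<subseteq> V (r - 1)"
    using V_mono r_gt_2 by simp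
  then show ?thesis
    using V_step [of 1] r_gt_2 unfolding U_def M_def by auto
qed

lemma M_psubset_UNIV: "M \<subset> UNIV"
  using V_step [of "r - 1"] r_gt_2 by (simp add: M_def V_r)

text \<open>On \<open>V j\<close> with \<open>j \<le> i\<close> the functional vanishes, and for
  larger \<open>j\<close> the vector \<open>u\<close> already lies in \<open>V (j - 1)\<close>.
  These rank-one elements are the test elements of all later arguments.\<close>

lemma outer_in_S:
  assumes "i \<le> r" "u \<in> V i" "\<And>x. x \<in> V i \<Longrightarrow> dotp y x = 0"
  shows "outer u y \<in> S"
  unfolding S_def
proof (intro CollectI allI impI ballI)
  fix j x assume j: "j < r" "x \<in> V (Suc j)"
  show "outer u y *v x \<in> V j"
  proof (cases "Suc j \<le> i")
    case True
    then have "x \<in> V i"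
      using V_mono j assms by blast
    then show ?thesis
      using assms j by (simp add: outer_mult_vec)
  next
    case False
    then have "u \<in> V j"
      using V_mono [of i j] j assms by auto
    then show ?thesis
      using subspace_V [of j] j by (simp add: outer_mult_vec vec.subspace_scale)
  qed
qed

lemma zero_in_S: "0 \<in> S"
  by (simp add: S_def)

lemma add_in_S: "a \<in> S \<Longrightarrow> b \<in> S \<Longrightarrow> a + b \<in> S"
  by (auto simp: S_def matrix_vector_mult_add_rdistrib subspace_V vec.subspace_add)

lemma mult_in_S:
  assumes "a \<in> S" "b \<in> S"
  shows "a ** b \<in> S"
  unfolding S_def
proof (intro CollectI allI impI ballI)
  fix j x assume j: "j < r" "x \<in> V (Suc j)"
  have "b *v x \<in> V j"
    using assms j by (simp add: S_def)
  then have "b *v x \<in> V (Suc j)"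
    using V_step j by blast
  then have "a *v (b *v x) \<in> V j"
    using assms j by (simp add: S_def)
  then show "(a ** b) *v x \<in> V j"
    by (simp add: matrix_vector_mul_assoc)
qed

lemma mult_vec_in_V: "a \<in> S \<Longrightarrow> i < r \<Longrightarrow> x \<in> V (Suc i) \<Longrightarrow> a *v x \<in> V i"
  by (simp add: S_def)

text \<open>The nontrivial direction: if \<open>c *v x\<close> is outside \<open>V (Suc i)\<close>,
  take \<open>y\<close> vanishing on \<open>V (Suc i)\<close> but not at \<open>c *v x\<close>, and
  \<open>u\<close> in \<open>V (Suc i)\<close> outside \<open>V i\<close>. Then
  \<open>outer u y\<close> is in \<open>S\<close> and moves \<open>c *v x\<close> to a vector
  outside \<open>V i\<close>.\<close>

lemma socle_series_iff: "i \<le> r \<Longrightarrow> c \<in> socle_series S i \<longleftrightarrow> c \<in> S \<and> (\<forall>x. c *v x \<in> V i)"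
proof (induction i arbitrary: c)
  case 0
  then show ?case
    using zero_in_S matrix_eq [of c 0] by (auto simp: V_0)
next
  case (Suc i)
  have *: "\<forall>x. c *v x \<in> V (Suc i)" if c: "c \<in> S" and s: "\<forall>s\<in>S. \<forall>x. s *v (c *v x) \<in> V i"
  proof (rule ccontr)
    assume "\<not> (\<forall>x. c *v x \<in> V (Suc i))"
    then obtain x where "c *v x \<notin> V (Suc i)" by blast
    then obtain y where y: "\<And>w. w \<in> V (Suc i) \<Longrightarrow> dotp y w = 0" "dotp y (c *v x) = 1"
      using separating_functional [OF subspace_V] Suc.prems by blast
    obtain u where u: "u \<in> V (Suc i)" "u \<notin> V i"
      using V_step [of i] Suc.prems by auto
    have "outer u y \<in> S"
      using outer_in_S u y Suc.prems by blast
    then have "outer u y *v (c *v x) \<in> V i"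
      using s by blast
    then show False
      using u y by (simp add: outer_mult_vec)
  qed
  show ?case
  proof
    assume "c \<in> socle_series S (Suc i)"
    then have "c \<in> S" "\<forall>s\<in>S. \<forall>x. (s ** c) *v x \<in> V i"
      using Suc by auto
    then show "c \<in> S \<and> (\<forall>x. c *v x \<in> V (Suc i))"
      using * by (simp flip: matrix_vector_mul_assoc)
  next
    assume "c \<in> S \<and> (\<forall>x. c *v x \<in> V (Suc i))"
    then show "c \<in> socle_series S (Suc i)"
      using Suc mult_in_S mult_vec_in_V by (simp flip: matrix_vector_mul_assoc)
  qed
qed

lemma L_iff: "a \<in> L \<longleftrightarrow> a \<in> S \<and> (\<forall>x. a *v x \<in> U)"
  using socle_series_iff [of 1] r_gt_2 by (simp add: L_def U_def)

lemma mult_U_eq_0: "a \<in> S \<Longrightarrow> x \<in> U \<Longrightarrow> a *v x = 0"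
  using mult_vec_in_V [of a 0 x] r_gt_2 by (auto simp: U_def V_0)

lemma mult_vec_in_M: "a \<in> S \<Longrightarrow> a *v x \<in> M"
  using mult_vec_in_V [of a "r - 1" x] r_gt_2 by (auto simp: M_def V_r)

lemma outer_in_L: "u \<in> U \<Longrightarrow> (\<And>x. x \<in> U \<Longrightarrow> dotp y x = 0) \<Longrightarrow> outer u y \<in> L"
  using outer_in_S [of 1] r_gt_2 subspace_U
  by (auto simp: L_iff outer_mult_vec U_def vec.subspace_scale)

lemma functional_on_M:
  obtains z where "\<And>w. w \<in> M \<Longrightarrow> dotp z w = 0" "z \<noteq> 0"
proof -
  obtain x where "x \<notin> M"
    using M_psubset_UNIV by blast
  then show thesis
    using that separating_functional [OF subspace_M] by (metis dotp_zero_left zero_neq_one)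
qed

lemma outer_eq_0_iff: "z \<noteq> 0 \<Longrightarrow> outer u z = 0 \<longleftrightarrow> u = 0"
  by (auto simp: outer_def vec_eq_iff)

text \<open>Testing \<open>a\<close> against \<open>outer x z\<close> with \<open>x\<close> in
  \<open>M\<close> and \<open>z\<close> vanishing on \<open>M\<close> gives
  \<open>a *v x = 0\<close>. Conversely every element of \<open>S\<close> has its range in
  \<open>M\<close>.\<close>

lemma R_iff: "a \<in> R \<longleftrightarrow> a \<in> S \<and> (\<forall>x\<in>M. a *v x = 0)"
proof
  assume a: "a \<in> R"
  obtain z where z: "\<And>w. w \<in> M \<Longrightarrow> dotp z w = 0" "z \<noteq> 0"
    using functional_on_M by blast
  have "a *v x = 0" if "x \<in> M" for x
  proof -
    have "outer x z \<in> S"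
      using outer_in_S [of "r - 1" x z] z that by (auto simp: M_def)
    then have "a ** outer x z = 0"
      using a by (simp add: R_def left_annihilator_def)
    then show ?thesis
      using z outer_eq_0_iff by (auto simp: mult_outer)
  qed
  then show "a \<in> S \<and> (\<forall>x\<in>M. a *v x = 0)"
    using a by (simp add: R_def left_annihilator_def)
next
  assume "a \<in> S \<and> (\<forall>x\<in>M. a *v x = 0)"
  then show "a \<in> R"
    using mult_vec_in_M
    by (auto simp: R_def left_annihilator_def intro!: matrix_eqI simp flip: matrix_vector_mul_assoc)
qed

lemma outer_in_R: "w \<in> M \<Longrightarrow> (\<And>x. x \<in> M \<Longrightarrow> dotp z x = 0) \<Longrightarrow> outer w z \<in> R"
  using outer_in_S [of "r - 1"] by (auto simp: R_iff M_def outer_mult_vec)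

lemma L_subset_S: "L \<subseteq> S" and R_subset_S: "R \<subseteq> S"
  by (auto simp: L_iff R_iff)

end

section \<open>Functionals composed with matrices, and spans of few vectors\<close>

lemma dotp_vector_matrix: "dotp (y v* a) x = dotp y (a *v x)"
  unfolding dotp_def vector_matrix_mult_def matrix_vector_mult_def
  by (simp add: sum_distrib_left sum_distrib_right, subst sum.swap, simp add: ac_simps)

lemma span_singleton_swap:
  assumes "u \<in> vec.span {p}" "v \<in> vec.span {p}" "u \<noteq> 0"
  shows "v \<in> vec.span {u}"
proof -
  obtain c d where "u = c *s p" "v = d *s p"
    using assms by (auto simp: vec.span_singleton)
  moreover from this have "c \<noteq> 0"
    using assms by auto
  ultimately have "v = (d / c) *s u"
    by simp
  then show ?thesis
    by (auto simp: vec.span_singleton)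
qed

lemma span_singleton_subset: "vec.subspace W \<Longrightarrow> u \<in> W \<Longrightarrow> vec.span {u} \<subseteq> W"
  by (simp add: vec.span_minimal)

lemma subspace_not_subset:
  assumes "vec.dim X < vec.dim Y"
  obtains y where "y \<in> Y" "y \<notin> X"
  using assms vec.dim_subset [of Y X] by (meson leD subsetI)

lemma two_independent:
  assumes "2 \<le> vec.dim Y"
  obtains u v where "u \<in> Y" "u \<noteq> 0" "v \<in> Y" "v \<notin> vec.span {u}"
proof -
  obtain u where u: "u \<in> Y" "u \<notin> {0}"
    using subspace_not_subset [of "{0}" Y] assms by (metis pos2 vec.dim_singleton order_less_le_trans)
  have "vec.dim (vec.span {u}) < vec.dim Y"
    using assms by auto
  then show thesis
    using that u subspace_not_subset by (metis singletonI)
qed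

lemma subspace_eq_span_singleton:
  assumes "vec.subspace W" "vec.dim W = 1" "u \<in> W" "u \<noteq> 0"
  shows "W = vec.span {u}"
  using assms vec.subspace_dim_equal [of "vec.span {u}" W] span_singleton_subset [of W u]
  by simp

lemma range_mult_vec_subset:
  fixes a :: "'a::field ^ 'n ^ 'm"
  assumes "vec.subspace W" "\<And>x. x \<in> E \<Longrightarrow> a *v x \<in> W" "x \<in> vec.span E"
  shows "a *v x \<in> W"
  using assms(3)
  by (induction rule: vec.span_induct_alt)
    (use assms(1,2) in \<open>auto simp: matrix_vector_right_distrib vec.scale vec.subspace_0
      intro!: vec.subspace_add vec.subspace_scale\<close>)

context flag
begin

text \<open>Such a matrix maps \<open>V i\<close> to \<open>0\<close> for \<open>i < r\<close>, so
  only the last step of the flag has to be checked.\<close>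

lemma R_I:
  assumes "\<And>x. x \<in> M \<Longrightarrow> a *v x = 0" "\<And>x. a *v x \<in> M"
  shows "a \<in> R"
proof -
  have "a *v x \<in> V i" if "i < r" "x \<in> V (Suc i)" for i x
  proof (cases "Suc i = r")
    case True
    then show ?thesis
      using assms(2) M_def by auto
  next
    case False
    then have "V (Suc i) \<subseteq> M"
      using that unfolding M_def by (intro V_mono) auto
    then have "x \<in> M"
      using that by blast
    then show ?thesis
      using assms(1) that by simp
  qed
  then show ?thesis
    using assms(1) by (simp add: R_iff S_def)
qed

lemma functional_on_M_normalized:
  obtains z e where "\<And>w. w \<in> M \<Longrightarrow> dotp z w = 0" "dotp z e = 1"
proof -
  obtain e where "e \<notin> M"
    using M_psubset_UNIV by blast
  from separating_functional [OF subspace_M this] that show thesis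
    by blast
qed

lemma functional_on_U:
  obtains \<eta> w where "\<And>u. u \<in> U \<Longrightarrow> dotp \<eta> u = 0" "w \<in> M" "dotp \<eta> w = 1"
proof -
  obtain w where w: "w \<in> M" "w \<notin> U"
    using U_psubset_M by blast
  from separating_functional [OF subspace_U w(2)] w(1) that show thesis
    by blast
qed

text \<open>The right-hand side says that the right ideal \<open>a R\<close> is contained in
  \<open>b R\<close>. Elements of \<open>R\<close> are arbitrary linear maps from the quotient by
  \<open>M\<close> into \<open>M\<close>, so solving \<open>a ** c = b ** d\<close> amounts to
  choosing preimages under \<open>b\<close> inside \<open>M\<close>.\<close>

lemma image_M_subset_iff:
  fixes a b :: "'a ^ 'n ^ 'n"
  shows "(*v) a ` M \<subseteq> (*v) b ` M \<longleftrightarrow> (\<forall>c\<in>R. \<exists>d\<in>R. a ** c = b ** d)"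
proof
  assume sub: "(*v) a ` M \<subseteq> (*v) b ` M"
  show "\<forall>c\<in>R. \<exists>d\<in>R. a ** c = b ** d"
  proof
    fix c assume c: "c \<in> R"
    then have cS: "c \<in> S"
      using R_subset_S by blast
    obtain B where B: "B \<subseteq> M" "vec.independent B" "vec.span B = M"
      using vec.basis_subspace_exists [OF subspace_M] by metis
    then obtain E where E: "B \<subseteq> E" "vec.independent E" "vec.span E = UNIV"
      using vec.maximal_independent_subset_extend [of B UNIV] by (metis subset_UNIV top.extremum_uniqueI)
    \<comment> \<open>\<open>p x\<close> is a preimage of \<open>a *v (c *v x)\<close> under
      \<open>b\<close>; the matrix \<open>d\<close> below takes these values on the basis vectors
      outside \<open>B\<close> and vanishes on \<open>M\<close>.\<close>
    define p where "p x = (SOME m. m \<in> M \<and> b *v m = a *v (c *v x))" for x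
    have p: "p x \<in> M \<and> b *v p x = a *v (c *v x)" for x
      unfolding p_def
    proof (rule someI_ex)
      have "a *v (c *v x) \<in> (*v) a ` M"
        using mult_vec_in_M cS by blast
      then show "\<exists>m. m \<in> M \<and> b *v m = a *v (c *v x)"
        using sub by (metis imageE subsetD)
    qed
    obtain d where d: "\<And>e. e \<in> E \<Longrightarrow> d *v e = (if e \<in> B then 0 else p e)"
      using linear_extension_matrix [OF E(2), of "\<lambda>e. if e \<in> B then 0 else p e"] by blast
    have "d *v x \<in> M" for x
    proof (rule range_mult_vec_subset [OF subspace_M])
      fix e assume "e \<in> E"
      then show "d *v e \<in> M"
        using d [of e] p [of e] subspace_M by (simp add: vec.subspace_0)
    qed (simp add: E)
    moreover have "d *v x = 0" if "x \<in> M" for x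
    proof -
      have "d *v x = 0 *v x"
      proof (rule matrix_eq_on_span)
        fix e assume "e \<in> B"
        then show "d *v e = 0 *v e"
          using d [of e] E(1) by auto
      qed (use that B in blast)
      then show ?thesis
        by simp
    qed
    ultimately have "d \<in> R"
      by (simp add: R_I)
    moreover have "a ** c = b ** d"
    proof (rule matrix_eqI)
      fix x
      show "(a ** c) *v x = (b ** d) *v x"
      proof (rule matrix_eq_on_span)
        fix e assume "e \<in> E"
        then show "(a ** c) *v e = (b ** d) *v e"
          using d [of e] p [of e] c B by (auto simp: R_iff simp flip: matrix_vector_mul_assoc)
      qed (simp add: E)
    qed
    ultimately show "\<exists>d\<in>R. a ** c = b ** d" by blast
  qed
next
  assume *: "\<forall>c\<in>R. \<exists>d\<in>R. a ** c = b ** d"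
  obtain z e where z: "\<And>w. w \<in> M \<Longrightarrow> dotp z w = 0" "dotp z e = 1"
    using functional_on_M_normalized by blast
  show "(*v) a ` M \<subseteq> (*v) b ` M"
  proof
    fix y assume "y \<in> (*v) a ` M"
    then obtain w where w: "w \<in> M" "y = a *v w" by blast
    then obtain d where d: "d \<in> R" "outer y z = b ** d"
      using * outer_in_R [of w z] z by (metis mult_outer)
    have "y = outer y z *v e"
      using z by (simp add: outer_mult_vec)
    also have "\<dots> = b *v (d *v e)"
      by (simp add: d matrix_vector_mul_assoc)
    finally show "y \<in> (*v) b ` M"
      using d mult_vec_in_M R_subset_S by blast
  qed
qed

text \<open>If \<open>c *v x\<close> is outside \<open>W\<close>, then \<open>outer u y\<close> with
  \<open>0 \<noteq> u \<in> U\<close> and \<open>y\<close> separating \<open>c *v x\<close> from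
  \<open>W\<close> is an element of \<open>L\<close> that kills \<open>W\<close> but not
  \<open>c\<close>. So a subspace \<open>W\<close> above \<open>U\<close> is recovered from the
  elements of \<open>L\<close> that vanish on it.\<close>

lemma annihilated_iff_range_subset:
  assumes W: "vec.subspace W" "U \<subseteq> W" and c: "c \<in> R"
  shows "(\<forall>a\<in>L. (\<forall>w\<in>W. a *v w = 0) \<longrightarrow> a ** c = 0) \<longleftrightarrow> (\<forall>x. c *v x \<in> W)"
proof (intro iffI allI)
  fix x
  assume *: "\<forall>a\<in>L. (\<forall>w\<in>W. a *v w = 0) \<longrightarrow> a ** c = 0"
  show "c *v x \<in> W"
  proof (rule ccontr)
    assume "c *v x \<notin> W"
    then obtain y where y: "\<And>w. w \<in> W \<Longrightarrow> dotp y w = 0" "dotp y (c *v x) = 1"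
      using separating_functional W by blast
    obtain u where u: "u \<in> U" "u \<noteq> 0"
      using V_step [of 0] r_gt_2 V_0 by (auto simp: U_def)
    have "outer u y \<in> L"
      using outer_in_L u y W by blast
    then have "outer u y ** c = 0"
      using * y by (simp add: outer_mult_vec)
    then have "outer u y *v (c *v x) = 0"
      by (simp add: matrix_vector_mul_assoc)
    then show False
      using u y by (simp add: outer_mult_vec)
  qed
qed (auto intro!: matrix_eqI simp flip: matrix_vector_mul_assoc)

lemma rank_one_in_L:
  assumes "u \<in> U"
  obtains a where "a \<in> L" "(*v) a ` M = vec.span {u}"
proof -
  obtain \<eta> w where \<eta>: "\<And>u. u \<in> U \<Longrightarrow> dotp \<eta> u = 0" "w \<in> M" "dotp \<eta> w = 1"
    using functional_on_U by blast
  have "(*v) (outer u \<eta>) ` M = vec.span {u}"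
  proof
    show "(*v) (outer u \<eta>) ` M \<subseteq> vec.span {u}"
      by (auto simp: outer_mult_vec vec.span_singleton)
    show "vec.span {u} \<subseteq> (*v) (outer u \<eta>) ` M"
    proof (rule span_singleton_subset)
      show "u \<in> (*v) (outer u \<eta>) ` M"
        using \<eta> by (auto simp: outer_mult_vec image_iff intro!: bexI [of _ w])
    qed (simp add: subspace_range subspace_M)
  qed
  then show thesis
    using that outer_in_L assms \<eta> by blast
qed

text \<open>Two vectors \<open>w\<close>, \<open>w'\<close> of \<open>M\<close> independent modulo
  \<open>U\<close> can be sent to vectors of \<open>U\<close> spanning any prescribed subspace of
  dimension at most two; this is where \<open>M\<close> has to exceed \<open>U\<close> by two
  dimensions.\<close>

lemma rank_two_in_L:
  assumes "vec.dim U + 2 \<le> vec.dim M" "u \<in> U" "v \<in> U"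
  obtains a where "a \<in> L" "(*v) a ` M = vec.span {u, v}"
proof -
  obtain w where w: "w \<in> M" "w \<notin> U"
    using U_psubset_M by blast
  \<comment> \<open>Since \<open>y'\<close> vanishes on \<open>X\<close>, the pair \<open>y\<close>,
    \<open>y'\<close> is triangular on \<open>w\<close>, \<open>w'\<close>:
    \<open>a *v w = u\<close>, while \<open>a *v w'\<close> is \<open>v\<close> up to a multiple of
    \<open>u\<close>.\<close>
  define X where "X = vec.span (insert w U)"
  have X: "vec.subspace X" "U \<subseteq> X" "w \<in> X"
    by (auto simp: X_def vec.span_base)
  have "vec.dim X < vec.dim M"
    using dim_span_insert [OF subspace_U] w assms by (simp add: X_def)
  then obtain w' where w': "w' \<in> M" "w' \<notin> X"
    using subspace_not_subset by blast
  obtain y where y: "\<And>x. x \<in> U \<Longrightarrow> dotp y x = 0" "dotp y w = 1"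
    using separating_functional [OF subspace_U] w by blast
  obtain y' where y': "\<And>x. x \<in> X \<Longrightarrow> dotp y' x = 0" "dotp y' w' = 1"
    using separating_functional [OF X(1)] w' by blast
  define a where "a = outer u y + outer v y'"
  have a: "a *v x = dotp y x *s u + dotp y' x *s v" for x
    by (simp add: a_def matrix_vector_mult_add_rdistrib outer_mult_vec)
  have "outer u y \<in> L" "outer v y' \<in> L"
    using outer_in_L assms y y' X by blast+
  then have aL: "a \<in> L"
    using subspace_U by (auto simp: L_iff a_def add_in_S matrix_vector_mult_add_rdistrib vec.subspace_add)
  have sM: "vec.subspace ((*v) a ` M)"
    by (simp add: subspace_range subspace_M)
  have "(*v) a ` M = vec.span {u, v}"
  proof
    show "(*v) a ` M \<subseteq> vec.span {u, v}"
      by (auto simp: a vec.span_base intro!: vec.span_add vec.span_scale)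
    have "a *v w = u"
      using y y' X by (simp add: a)
    then have u: "u \<in> (*v) a ` M"
      using w by blast
    have "a *v w' \<in> (*v) a ` M"
      using w' by blast
    moreover have "v = a *v w' - dotp y w' *s u"
      using y' by (simp add: a)
    ultimately have "v \<in> (*v) a ` M"
      using u sM by (metis vec.subspace_diff vec.subspace_scale)
    then show "vec.span {u, v} \<subseteq> (*v) a ` M"
      using u sM by (simp add: vec.span_minimal)
  qed
  then show thesis
    using that aL by blast
qed

lemma image_M_subset_U: "a \<in> L \<Longrightarrow> (*v) a ` M \<subseteq> U"
  by (auto simp: L_iff)

lemma nonzero_in_U: obtains u where "u \<in> U" "u \<noteq> 0"
  using V_step [of 0] r_gt_2 V_0 by (auto simp: U_def)

lemma dim_U_pos: "0 < vec.dim U"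
  using nonzero_in_U by (metis gr0I singletonD subsetD vec.dim_eq_0)

text \<open>\<open>U\<close> is a line exactly if every element of \<open>L\<close> that is nonzero
  on \<open>M\<close> is a greatest element in the order by images of \<open>M\<close>. That order
  is multiplicative by \<open>image_M_subset_iff\<close>, so isomorphisms detect this case.\<close>

lemma dim_U_eq_1_iff:
  "vec.dim U = 1 \<longleftrightarrow> (\<forall>a\<in>L. \<forall>b\<in>L. \<not> (*v) b ` M \<subseteq> (*v) 0 ` M \<longrightarrow> (*v) a ` M \<subseteq> (*v) b ` M)"
proof (intro iffI ballI impI)
  fix a b assume *: "vec.dim U = 1" "a \<in> L" "b \<in> L" "\<not> (*v) b ` M \<subseteq> (*v) 0 ` M"
  then obtain u where u: "u \<in> (*v) b ` M" "u \<noteq> 0"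
    using subspace_M vec.subspace_0 by (force simp: image_iff)
  then have "U = vec.span {u}"
    using subspace_eq_span_singleton subspace_U * image_M_subset_U by blast
  also have "\<dots> \<subseteq> (*v) b ` M"
    using u by (simp add: span_singleton_subset subspace_range subspace_M)
  finally show "(*v) a ` M \<subseteq> (*v) b ` M"
    using image_M_subset_U * by blast
next
  assume *: "\<forall>a\<in>L. \<forall>b\<in>L. \<not> (*v) b ` M \<subseteq> (*v) 0 ` M \<longrightarrow> (*v) a ` M \<subseteq> (*v) b ` M"
  show "vec.dim U = 1"
  proof (rule ccontr)
    assume "vec.dim U \<noteq> 1"
    then have "2 \<le> vec.dim U"
      using dim_U_pos by simp
    then obtain u v where uv: "u \<in> U" "u \<noteq> 0" "v \<in> U" "v \<notin> vec.span {u}"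
      using two_independent by blast
    obtain a where a: "a \<in> L" "(*v) a ` M = vec.span {v}"
      using rank_one_in_L uv by blast
    obtain b where b: "b \<in> L" "(*v) b ` M = vec.span {u}"
      using rank_one_in_L uv by blast
    have "u \<in> (*v) b ` M" "u \<notin> (*v) 0 ` M"
      using uv b by (auto simp: vec.span_base)
    then have "(*v) a ` M \<subseteq> (*v) b ` M"
      using * a b by blast
    then show False
      using a b uv by (auto simp: vec.span_base)
  qed
qed

section \<open>Products when \<open>M\<close> exceeds \<open>U\<close> by one dimension\<close>

lemma range_product:
  assumes "M = vec.span (insert w U)" "a \<in> S" "b \<in> S"
  shows "(a ** b) *v x \<in> vec.span {a *v w}"
proof -
  have "b *v x \<in> vec.span (insert w U)"
    using assms mult_vec_in_M by blast
  \<comment> \<open>Modulo \<open>U\<close>, which \<open>a\<close> kills, the vector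
    \<open>b *v x\<close> is a multiple of \<open>w\<close>.\<close>
  then obtain k where "b *v x - k *s w \<in> U"
    using subspace_U by (metis vec.span_breakdown_eq vec.span_eq_iff)
  then have "a *v (b *v x - k *s w) = 0"
    using mult_U_eq_0 assms by blast
  then have "(a ** b) *v x = k *s (a *v w)"
    by (simp add: matrix_vector_mul_assoc [symmetric] vec.diff vec.scale)
  then show ?thesis
    by (auto simp: vec.span_singleton)
qed

lemma M_eq_span_insert:
  assumes "vec.dim M = Suc (vec.dim U)" "w \<in> M" "w \<notin> U"
  shows "M = vec.span (insert w U)"
  using assms dim_span_insert [OF subspace_U] subspace_M U_psubset_M
    vec.subspace_dim_equal [of "vec.span (insert w U)" M]
  by (auto simp: vec.span_minimal)

text \<open>By \<open>range_product\<close> a product has rank at most one, while the values at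
  \<open>e\<close> and \<open>e'\<close> put both \<open>u\<close> and \<open>v\<close> into the
  range of the sum.\<close>

lemma sum_outer_not_product:
  assumes M: "vec.dim M = Suc (vec.dim U)" and ab: "a \<in> S" "b \<in> S"
    and u: "u \<noteq> 0" "v \<notin> vec.span {u}"
    and z: "dotp z e = 1" "dotp z' e = 0" "dotp z' e' = 1"
  shows "outer u z + outer v z' \<noteq> a ** b"
proof
  assume eq: "outer u z + outer v z' = a ** b"
  obtain w where w: "w \<in> M" "w \<notin> U"
    using U_psubset_M by blast
  have x: "dotp z x *s u + dotp z' x *s v \<in> vec.span {a *v w}" for x
    using range_product [OF M_eq_span_insert [OF M w] ab, of x]
    by (simp add: eq [symmetric] matrix_vector_mult_add_rdistrib outer_mult_vec)
  have u': "u \<in> vec.span {a *v w}"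
    using x [of e] z by simp
  then have "(dotp z e' *s u + dotp z' e' *s v) - dotp z e' *s u \<in> vec.span {a *v w}"
    using x [of e'] by (intro vec.span_diff vec.span_scale)
  then have "v \<in> vec.span {a *v w}"
    using z by simp
  then show False
    using u u' span_singleton_swap by blast
qed

lemma two_functionals_on_M:
  assumes "vec.dim M + 2 \<le> CARD('n)"
  obtains z z' e e' where "\<And>w. w \<in> M \<Longrightarrow> dotp z w = 0" "\<And>w. w \<in> M \<Longrightarrow> dotp z' w = 0"
    "dotp z e = 1" "dotp z' e = 0" "dotp z' e' = 1"
proof -
  obtain e where e: "e \<notin> M"
    using M_psubset_UNIV by blast
  define X where "X = vec.span (insert e M)"
  have X: "vec.subspace X" "M \<subseteq> X" "e \<in> X"
    by (auto simp: X_def vec.span_base)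
  have "vec.dim X < vec.dim (UNIV :: ('a^'n) set)"
    using dim_span_insert [OF subspace_M] e assms by (simp add: X_def vec_dim_card del: vec.dim_UNIV)
  then obtain e' where e': "e' \<notin> X"
    using subspace_not_subset by blast
  obtain z where "\<And>w. w \<in> M \<Longrightarrow> dotp z w = 0" "dotp z e = 1"
    using separating_functional [OF subspace_M e] by blast
  moreover obtain z' where "\<And>w. w \<in> X \<Longrightarrow> dotp z' w = 0" "dotp z' e' = 1"
    using separating_functional [OF X(1) e'] by blast
  ultimately show thesis
    using that [of z z' e e'] X by blast
qed

text \<open>\<open>L \<inter> R\<close> consists of the matrices that kill \<open>M\<close> and map
  into \<open>U\<close>. If \<open>U\<close> and the quotient by \<open>M\<close> both have
  dimension at least two, it contains a matrix of rank two, which is no product; otherwise all its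
  elements have rank at most one and factor through \<open>w\<close>. The left side is invariant
  under isomorphism.\<close>

lemma all_products_iff:
  assumes M: "vec.dim M = Suc (vec.dim U)"
  shows "(\<forall>x \<in> L \<inter> R. \<exists>a\<in>S. \<exists>b\<in>S. x = a ** b) \<longleftrightarrow> vec.dim U = 1 \<or> vec.dim M + 1 = CARD('n)"
proof
  assume *: "\<forall>x \<in> L \<inter> R. \<exists>a\<in>S. \<exists>b\<in>S. x = a ** b"
  show "vec.dim U = 1 \<or> vec.dim M + 1 = CARD('n)"
  proof (rule ccontr)
    assume "\<not> ?thesis"
    moreover have "vec.dim M < CARD('n)"
      using vec.dim_psubset [of M UNIV] M_psubset_UNIV subspace_M
      by (metis vec.span_UNIV vec.span_eq_iff vec_dim_card)
    ultimately have dims: "2 \<le> vec.dim U" "vec.dim M + 2 \<le> CARD('n)"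
      using dim_U_pos by auto
    then obtain u v where uv: "u \<in> U" "u \<noteq> 0" "v \<in> U" "v \<notin> vec.span {u}"
      using two_independent by blast
    obtain z z' e e' where z: "\<And>w. w \<in> M \<Longrightarrow> dotp z w = 0" "\<And>w. w \<in> M \<Longrightarrow> dotp z' w = 0"
      "dotp z e = 1" "dotp z' e = 0" "dotp z' e' = 1"
      using two_functionals_on_M dims by blast
    have "outer u z \<in> L \<inter> R" "outer v z' \<in> L \<inter> R"
      using uv z U_psubset_M by (auto intro!: outer_in_L outer_in_R)
    then have "outer u z + outer v z' \<in> L \<inter> R"
      by (auto simp: L_iff R_iff add_in_S matrix_vector_mult_add_rdistrib subspace_U vec.subspace_add)
    then show False
      using * sum_outer_not_product [OF M] uv z by blast
  qed
next
  assume d: "vec.dim U = 1 \<or> vec.dim M + 1 = CARD('n)"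
  show "\<forall>x \<in> L \<inter> R. \<exists>a\<in>S. \<exists>b\<in>S. x = a ** b"
  proof
    fix x assume x: "x \<in> L \<inter> R"
    obtain \<eta> w where \<eta>: "\<And>u. u \<in> U \<Longrightarrow> dotp \<eta> u = 0" "w \<in> M" "dotp \<eta> w = 1"
      using functional_on_U by blast
    have "\<exists>u z. x = outer u z \<and> u \<in> U \<and> (\<forall>m\<in>M. dotp z m = 0)"
      using d
    proof
      assume "vec.dim U = 1"
      obtain u where u: "u \<in> U" "u \<noteq> 0"
        using nonzero_in_U by blast
      then have U: "U = vec.span {u}"
        using subspace_eq_span_singleton subspace_U \<open>vec.dim U = 1\<close> by blast
      \<comment> \<open>\<open>\<theta>\<close> reads off the coefficient of \<open>u\<close>, so
        the rows of \<open>x\<close> are multiples of \<open>\<theta> v* x\<close>.\<close>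
      obtain \<theta> where \<theta>: "dotp \<theta> u = 1"
        using separating_functional [of "{0}" u] u by auto
      have "outer u (\<theta> v* x) *v v = x *v v" for v
      proof -
        have "x *v v \<in> vec.span {u}"
          using x U by (auto simp: L_iff)
        then show ?thesis
          using \<theta> by (auto simp: vec.span_singleton outer_mult_vec dotp_vector_matrix dotp_scale_right)
      qed
      then have "x = outer u (\<theta> v* x)"
        by (metis matrix_eqI)
      moreover have "\<forall>m\<in>M. dotp (\<theta> v* x) m = 0"
        using x by (simp add: dotp_vector_matrix R_iff)
      ultimately show ?thesis
        using u by blast
    next
      assume dM: "vec.dim M + 1 = CARD('n)"
      obtain z e where z: "\<And>w. w \<in> M \<Longrightarrow> dotp z w = 0" "dotp z e = 1"
        using functional_on_M_normalized by blast
      then have "e \<notin> M"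
        by force
      then have "vec.span (insert e M) = UNIV"
        using dim_span_insert [OF subspace_M] dM vec.subspace_dim_equal [of "vec.span (insert e M)" UNIV]
        by (simp add: vec_dim_card del: vec.dim_UNIV)
      \<comment> \<open>Here \<open>e\<close> spans the space modulo \<open>M\<close>, so
        \<open>x\<close> is determined by its value at \<open>e\<close> and \<open>z\<close> is the
        coordinate along \<open>e\<close>.\<close>
      have "x *v v = outer (x *v e) z *v v" for v
      proof -
        obtain k where k: "v - k *s e \<in> M"
          using \<open>vec.span (insert e M) = UNIV\<close> subspace_M
          by (metis UNIV_I vec.span_breakdown_eq vec.span_eq_iff)
        have "x *v (v - k *s e) = 0"
          using x k by (simp add: R_iff)
        moreover have "dotp z v = k"
          using z(1) [OF k] z(2) dotp_add_right [of z "v - k *s e" "k *s e"] by (simp add: dotp_scale_right)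
        ultimately show ?thesis
          by (simp add: outer_mult_vec vec.diff vec.scale)
      qed
      then have "x = outer (x *v e) z"
        by (metis matrix_eqI)
      then show ?thesis
        using x z by (metis IntD1 L_iff)
    qed
    then obtain u z where uz: "x = outer u z" "u \<in> U" "\<forall>m\<in>M. dotp z m = 0"
      by blast
    \<comment> \<open>The factorisation through \<open>w\<close>: \<open>outer w z\<close> leads
      into \<open>M\<close> and \<open>outer u \<eta>\<close> sends \<open>w\<close> to
      \<open>u\<close>.\<close>
    then have "outer u \<eta> \<in> S" "outer w z \<in> S" "x = outer u \<eta> ** outer w z"
      using \<eta> outer_in_L [of u \<eta>] outer_in_R [of w z] L_subset_S R_subset_S
      by (auto simp: mult_outer outer_mult_vec)
    then show "\<exists>a\<in>S. \<exists>b\<in>S. x = a ** b"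
      by blast
  qed
qed

end

section \<open>Invariants of isomorphisms\<close>

lemma finite_UNIV_vec:
  assumes "finite (UNIV :: 'a set)"
  shows "finite (UNIV :: ('a ^ 'n) set)"
proof -
  have "finite (UNIV :: ('n \<Rightarrow> 'a) set)"
    using finite_PiE [of "UNIV :: 'n set" "\<lambda>_. UNIV :: 'a set"] assms by (simp add: PiE_UNIV_domain)
  then show ?thesis
    using finite_imageI [of UNIV vec_lambda] by (metis surj_def vec_lambda_eta)
qed

text \<open>\<open>Y\<close> contains an isomorphic copy of \<open>X\<close> as a proper subspace.
  Over a finite field, cardinalities therefore determine dimensions.\<close>

lemma card_subspace_less:
  fixes X Y :: "('a::field ^ 'n) set"
  assumes "finite (UNIV :: 'a set)" "vec.subspace X" "vec.subspace Y" "vec.dim X < vec.dim Y"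
  shows "card X < card Y"
proof -
  have fin: "finite (UNIV :: ('a ^ 'n) set)"
    using assms(1) by (rule finite_UNIV_vec)
  obtain T where T: "vec.subspace T" "T \<subseteq> Y" "vec.dim T = vec.dim X"
    using vec.choose_subspace_of_subspace [of "vec.dim X" Y] assms
    by (metis less_imp_le vec.span_eq_iff)
  then obtain g where "g ` X = T" "inj_on g X"
    using vec.subspace_isomorphism [OF assms(2) T(1)] by metis
  then have "card X = card T"
    by (metis card_image)
  also have "T \<noteq> Y"
    using T assms by auto
  then have "card T < card Y"
    using T fin by (meson finite_subset psubsetI psubset_card_mono subset_UNIV)
  finally show ?thesis .
qed

locale flag_iso = A: flag V r + B: flag V' r
  for V V' :: "nat \<Rightarrow> ('a::field ^ 'n) set" and r +
  fixes f :: "'a ^ 'n ^ 'n \<Rightarrow> 'a ^ 'n ^ 'n"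
  assumes bij: "bij_betw f A.S B.S"
    and f_mult: "\<And>a b. a \<in> A.S \<Longrightarrow> b \<in> A.S \<Longrightarrow> f (a ** b) = f a ** f b"
begin

text \<open>Lets every inequality below be applied in both directions.\<close>

lemma inverse: "flag_iso V' V r (inv_into A.S f)"
proof unfold_locales
  show "bij_betw (inv_into A.S f) B.S A.S"
    by (rule bij_betw_inv_into [OF bij])
  fix a b assume "a \<in> B.S" "b \<in> B.S"
  then obtain x y where "x \<in> A.S" "y \<in> A.S" "a = f x" "b = f y"
    using bij unfolding bij_betw_def by blast
  moreover from this have "a ** b = f (x ** y)"
    by (simp add: f_mult)
  ultimately show "inv_into A.S f (a ** b) = inv_into A.S f a ** inv_into A.S f b"
    by (simp add: bij_betw_inv_into_left [OF bij] A.mult_in_S)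
qed

lemma f_in: "a \<in> A.S \<Longrightarrow> f a \<in> B.S"
  using bij by (auto simp: bij_betw_def)

lemma f_eq_iff: "a \<in> A.S \<Longrightarrow> b \<in> A.S \<Longrightarrow> f a = f b \<longleftrightarrow> a = b"
  using bij by (auto simp: bij_betw_def inj_on_def)

lemma f_ball: "(\<forall>b\<in>B.S. P b) \<longleftrightarrow> (\<forall>a\<in>A.S. P (f a))"
proof -
  have "B.S = f ` A.S"
    using bij by (simp add: bij_betw_def)
  then show ?thesis
    by simp
qed

lemma f_zero: "f 0 = 0"
proof -
  obtain a where "a \<in> A.S" "f a = 0"
    using bij B.zero_in_S by (metis bij_betw_imp_surj_on imageE)
  then show ?thesis
    using f_mult [OF A.zero_in_S, of a] by simp
qed

lemma f_eq_0_iff: "a \<in> A.S \<Longrightarrow> f a = 0 \<longleftrightarrow> a = 0"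
  using f_eq_iff A.zero_in_S f_zero by metis

lemma f_socle: "c \<in> A.S \<Longrightarrow> f c \<in> socle_series B.S i \<longleftrightarrow> c \<in> socle_series A.S i"
proof (induction i arbitrary: c)
  case (Suc i)
  then show ?case
    by (simp add: f_in f_ball A.mult_in_S flip: f_mult)
qed (simp add: f_eq_0_iff)

lemma f_L: "c \<in> A.S \<Longrightarrow> f c \<in> B.L \<longleftrightarrow> c \<in> A.L"
  unfolding A.L_def B.L_def by (rule f_socle)

lemma f_R: "c \<in> A.S \<Longrightarrow> f c \<in> B.R \<longleftrightarrow> c \<in> A.R"
  by (simp add: A.R_def B.R_def left_annihilator_def f_in f_ball f_eq_0_iff A.mult_in_S flip: f_mult)

lemma S_cases:
  assumes "b \<in> B.S"
  obtains a where "a \<in> A.S" "b = f a"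
  using assms bij unfolding bij_betw_def by blast

lemma L_cases:
  assumes "b \<in> B.L"
  obtains a where "a \<in> A.L" "b = f a"
  using assms S_cases B.L_subset_S f_L by blast

lemma R_cases:
  assumes "b \<in> B.R"
  obtains a where "a \<in> A.R" "b = f a"
  using assms S_cases B.R_subset_S f_R by blast

lemma LI: "a \<in> A.L \<Longrightarrow> a \<in> A.S" and RI: "a \<in> A.R \<Longrightarrow> a \<in> A.S"
  using A.L_subset_S A.R_subset_S by auto

lemma f_image_M_subset:
  assumes "a \<in> A.S" "b \<in> A.S"
  shows "(*v) (f a) ` B.M \<subseteq> (*v) (f b) ` B.M \<longleftrightarrow> (*v) a ` A.M \<subseteq> (*v) b ` A.M"
proof -
  have "(\<forall>c\<in>B.R. \<exists>d\<in>B.R. f a ** c = f b ** d) \<longleftrightarrow> (\<forall>c\<in>A.R. \<exists>d\<in>A.R. f a ** f c = f b ** f d)"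
  proof (intro iffI ballI)
    fix c
    assume *: "\<forall>c\<in>B.R. \<exists>d\<in>B.R. f a ** c = f b ** d" and "c \<in> A.R"
    then obtain d where "d \<in> B.R" "f a ** f c = f b ** d"
      using f_R RI by blast
    then show "\<exists>d\<in>A.R. f a ** f c = f b ** f d"
      using R_cases by metis
  next
    fix c
    assume *: "\<forall>c\<in>A.R. \<exists>d\<in>A.R. f a ** f c = f b ** f d" and "c \<in> B.R"
    then obtain c' where c': "c' \<in> A.R" "c = f c'"
      using R_cases by blast
    then obtain d where "d \<in> A.R" "f a ** f c' = f b ** f d"
      using * by blast
    then show "\<exists>d\<in>B.R. f a ** c = f b ** d"
      using f_R RI c' by blast
  qed
  also have "\<dots> \<longleftrightarrow> (\<forall>c\<in>A.R. \<exists>d\<in>A.R. a ** c = b ** d)"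
    using assms by (auto simp: RI f_eq_iff A.mult_in_S simp flip: f_mult)
  finally show ?thesis
    by (simp add: A.image_M_subset_iff B.image_M_subset_iff)
qed

text \<open>A strictly monotone map \<open>\<phi>\<close> sends the subspaces from
  \<open>A.U\<close> to \<open>V i\<close> to subspaces of \<open>B.M\<close>, with
  \<open>B.U \<subseteq> \<phi> A.U\<close> and \<open>\<phi> (V i) \<subseteq> V' i\<close>.
  Comparing dimensions along a chain gives the claim.\<close>

lemma dim_V_le:
  assumes i: "1 \<le> i" "i < r"
  shows "vec.dim (V i) + vec.dim B.U \<le> vec.dim (V' i) + vec.dim A.U"
proof -
  \<comment> \<open>\<open>\<phi> W\<close> is the common kernel in \<open>B.M\<close> of the images
    of those elements of \<open>L\<close> that kill \<open>W\<close>.\<close>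
  define \<phi> where "\<phi> W = {x \<in> B.M. \<forall>a\<in>A.L. (\<forall>w\<in>W. a *v w = 0) \<longrightarrow> f a *v x = 0}" for W
  have sub: "vec.subspace (\<phi> W)" for W
    using B.subspace_M
    by (auto simp: \<phi>_def vec.subspace_def matrix_vector_right_distrib vec.scale)
  have key: "(\<forall>x. f c *v x \<in> \<phi> W) \<longleftrightarrow> (\<forall>x. c *v x \<in> W)"
    if "c \<in> A.R" "vec.subspace W" "A.U \<subseteq> W" for c W
  proof -
    have "(\<forall>x. f c *v x \<in> \<phi> W) \<longleftrightarrow> (\<forall>a\<in>A.L. (\<forall>w\<in>W. a *v w = 0) \<longrightarrow> f a ** f c = 0)"
      using B.mult_vec_in_M f_in RI [OF that(1)]
      by (auto simp: \<phi>_def matrix_vector_mul_assoc intro!: matrix_eqI)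
    also have "\<dots> \<longleftrightarrow> (\<forall>a\<in>A.L. (\<forall>w\<in>W. a *v w = 0) \<longrightarrow> a ** c = 0)"
      using that by (auto simp: LI RI f_eq_0_iff A.mult_in_S simp flip: f_mult)
    finally show ?thesis
      using A.annihilated_iff_range_subset that by simp
  qed
  have UV: "A.U \<subseteq> V i" "V i \<subseteq> A.M"
    using A.V_mono [of 1 i] A.V_mono [of i "r - 1"] i unfolding A.U_def A.M_def by auto
  have strict: "\<phi> W \<subset> \<phi> W'"
    if W: "vec.subspace W" "vec.subspace W'" "A.U \<subseteq> W" "W \<subset> W'" "W' \<subseteq> V i" for W W'
  proof
    show "\<phi> W \<subseteq> \<phi> W'"
      using W unfolding \<phi>_def by blast
    obtain w where w: "w \<in> W'" "w \<notin> W"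
      using W by blast
    obtain z e where z: "\<And>w. w \<in> A.M \<Longrightarrow> dotp z w = 0" "dotp z e = 1"
      using A.functional_on_M_normalized by blast
    \<comment> \<open>Its range is the line of \<open>w\<close>, which lies in \<open>W'\<close> but
      not in \<open>W\<close>; \<open>key\<close> transports the difference to
      \<open>\<phi>\<close>.\<close>
    have c: "outer w z \<in> A.R"
      using A.outer_in_R z w W UV by blast
    have "\<forall>x. outer w z *v x \<in> W'"
      using w W by (simp add: outer_mult_vec vec.subspace_scale)
    then have "\<forall>x. f (outer w z) *v x \<in> \<phi> W'"
      using key [OF c] W by blast
    moreover have "outer w z *v e \<notin> W"
      using w z by (simp add: outer_mult_vec)
    then have "\<not> (\<forall>x. f (outer w z) *v x \<in> \<phi> W)"
      using key [OF c] W by blast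
    ultimately show "\<phi> W \<noteq> \<phi> W'"
      by blast
  qed
  have "vec.dim (V i) + vec.dim (\<phi> A.U) \<le> vec.dim (\<phi> (V i)) + vec.dim A.U"
    using i by (intro strict_mono_dim_le A.subspace_U A.subspace_V UV sub strict) auto
  \<comment> \<open>Write \<open>outer x z\<close> as \<open>f c\<close>. By \<open>key\<close> the
    range of \<open>c\<close> lies in \<open>V i\<close>, which is membership in the socle series
    and hence passes to \<open>f c\<close>.\<close>
  moreover have "\<phi> (V i) \<subseteq> V' i"
  proof
    fix x assume x: "x \<in> \<phi> (V i)"
    obtain z e where z: "\<And>w. w \<in> B.M \<Longrightarrow> dotp z w = 0" "dotp z e = 1"
      using B.functional_on_M_normalized by blast
    have "outer x z \<in> B.R"
      using B.outer_in_R z x unfolding \<phi>_def by blast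
    then obtain c where c: "c \<in> A.R" "outer x z = f c"
      using R_cases by blast
    have "\<forall>y. f c *v y \<in> \<phi> (V i)"
      using x sub by (simp add: c(2)[symmetric] outer_mult_vec vec.subspace_scale)
    then have "\<forall>y. c *v y \<in> V i"
      using key c UV i A.subspace_V by auto
    then have "c \<in> socle_series A.S i"
      using A.socle_series_iff [of i c] i RI c by auto
    then have "f c \<in> socle_series B.S i"
      using f_socle RI c by blast
    then have "f c *v e \<in> V' i"
      using B.socle_series_iff [of i "f c"] i by auto
    then show "x \<in> V' i"
      using z by (simp add: c(2)[symmetric] outer_mult_vec)
  qed
  then have "vec.dim (\<phi> (V i)) \<le> vec.dim (V' i)"
    by (rule vec.dim_subset)
  moreover have "B.U \<subseteq> \<phi> A.U"
    using B.mult_U_eq_0 f_in LI B.U_psubset_M unfolding \<phi>_def by blast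
  then have "vec.dim B.U \<le> vec.dim (\<phi> A.U)"
    by (rule vec.dim_subset)
  ultimately show ?thesis
    by linarith
qed

text \<open>Fix \<open>c\<close> in \<open>R\<close> whose range is a line outside
  \<open>A.U\<close>. The products \<open>a ** c\<close> with \<open>a\<close> in \<open>L\<close>
  are of the form \<open>outer u z\<close> with one fixed \<open>z\<close>, so there are at most
  \<open>card A.U\<close> of them; their images, evaluated at a suitable vector \<open>v\<close>,
  fill all of \<open>B.U\<close>.\<close>

lemma card_U_le:
  assumes fin: "finite (UNIV :: 'a set)"
  shows "card B.U \<le> card A.U"
proof -
  have fin: "finite (UNIV :: ('a ^ 'n) set)"
    using assms(1) by (rule finite_UNIV_vec)
  obtain w where w: "w \<in> A.M" "w \<notin> A.U"
    using A.U_psubset_M by blast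
  obtain z e where z: "\<And>w. w \<in> A.M \<Longrightarrow> dotp z w = 0" "dotp z e = 1"
    using A.functional_on_M_normalized by blast
  define c where "c = outer w z"
  have c: "c \<in> A.R"
    unfolding c_def using A.outer_in_R z w by blast
  define P where "P = (\<lambda>a. a ** c) ` A.L"
  have "P \<subseteq> (\<lambda>u. outer u z) ` A.U"
    by (auto simp: P_def c_def mult_outer A.L_iff)
  then have P: "finite P" "card P \<le> card A.U"
    using fin finite_subset card_image_le
    by (meson finite_imageI subset_UNIV surj_card_le)+
  \<comment> \<open>Otherwise all of \<open>B.S\<close> would kill \<open>f c\<close>, although some
    \<open>a\<close> in \<open>L\<close> has \<open>a ** c \<noteq> 0\<close>.\<close>
  have "\<exists>v. f c *v v \<notin> B.U"
  proof (rule ccontr)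
    assume *: "\<not> (\<exists>v. f c *v v \<notin> B.U)"
    have "\<exists>a\<in>A.L. a ** c \<noteq> 0"
    proof -
      have "\<not> (\<forall>x. c *v x \<in> A.U)"
        using z w by (auto simp: c_def outer_mult_vec intro!: exI [of _ e])
      then show ?thesis
        using A.annihilated_iff_range_subset [OF A.subspace_U order.refl c] by blast
    qed
    then obtain a where a: "a \<in> A.L" "a ** c \<noteq> 0"
      by blast
    have "f a ** f c = 0"
      using * B.mult_U_eq_0 f_in LI a
      by (intro matrix_eqI) (simp flip: matrix_vector_mul_assoc)
    then show False
      using a c by (simp add: LI RI f_eq_0_iff A.mult_in_S flip: f_mult)
  qed
  then obtain v where v: "f c *v v \<notin> B.U"
    by blast
  obtain y where y: "\<And>u. u \<in> B.U \<Longrightarrow> dotp y u = 0" "dotp y (f c *v v) = 1"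
    using separating_functional [OF B.subspace_U v] by blast
  have "B.U \<subseteq> (\<lambda>x. f x *v v) ` P"
  proof
    fix u assume u: "u \<in> B.U"
    then have "outer u y \<in> B.L"
      using B.outer_in_L y by blast
    then obtain a where a: "a \<in> A.L" "outer u y = f a"
      using L_cases by blast
    have "f (a ** c) *v v = u"
      using a c y by (simp add: f_mult LI RI outer_mult_vec flip: matrix_vector_mul_assoc)
        (simp add: outer_mult_vec flip: a(2))
    then show "u \<in> (\<lambda>x. f x *v v) ` P"
      using a unfolding P_def by blast
  qed
  then show ?thesis
    using P surj_card_le le_trans by blast
qed

text \<open>In the order by images of \<open>M\<close>, the elements of \<open>L\<close> whose image
  is a line are the minimal nonzero ones, so \<open>f\<close> matches them. The choice
  \<open>u = 0\<close> covers the case that \<open>c\<close> vanishes on \<open>A.M\<close>.\<close>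

lemma rank_one_preimage:
  assumes "q \<in> B.U"
  obtains c u where "c \<in> A.L" "u \<in> A.U" "(*v) c ` A.M = vec.span {u}" "(*v) (f c) ` B.M = vec.span {q}"
proof -
  obtain b where "b \<in> B.L" "(*v) b ` B.M = vec.span {q}"
    using B.rank_one_in_L assms by blast
  then obtain c where c: "c \<in> A.L" "(*v) (f c) ` B.M = vec.span {q}"
    using L_cases by metis
  show thesis
  proof (cases "(*v) c ` A.M \<subseteq> (*v) 0 ` A.M")
    case True
    then have "(*v) c ` A.M \<subseteq> vec.span {0}"
      by auto
    moreover have "0 \<in> (*v) c ` A.M"
      using A.subspace_M by (simp add: subspace_range vec.subspace_0)
    ultimately show ?thesis
      using that [of c 0] c A.subspace_U by (auto simp: vec.subspace_0)
  next
    case False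
    then obtain u where u: "u \<in> (*v) c ` A.M" "u \<noteq> 0"
      using A.subspace_M vec.subspace_0 by (force simp: image_iff)
    then have uU: "u \<in> A.U"
      using A.image_M_subset_U c by blast
    then obtain b where b: "b \<in> A.L" "(*v) b ` A.M = vec.span {u}"
      using A.rank_one_in_L by blast
    have sub: "(*v) b ` A.M \<subseteq> (*v) c ` A.M"
      using u by (simp add: b span_singleton_subset subspace_range A.subspace_M)
    then have sub': "(*v) (f b) ` B.M \<subseteq> vec.span {q}"
      using f_image_M_subset [of b c] b c LI by simp
    have "u \<in> (*v) b ` A.M" "u \<notin> (*v) 0 ` A.M"
      using u b by (auto simp: vec.span_base)
    then have "\<not> (*v) (f b) ` B.M \<subseteq> (*v) (f 0) ` B.M"
      using f_image_M_subset [of b 0] b LI A.zero_in_S by blast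
    then obtain p where p: "p \<in> (*v) (f b) ` B.M" "p \<noteq> 0"
      using B.subspace_M vec.subspace_0 by (force simp: image_iff f_zero)
    have "q \<in> vec.span {p}"
      using span_singleton_swap [of p q q] p sub' vec.span_base [of q "{q}"] by blast
    then have "vec.span {q} \<subseteq> vec.span {p}"
      by (simp add: span_singleton_subset)
    also have "\<dots> \<subseteq> (*v) (f b) ` B.M"
      using p by (simp add: span_singleton_subset subspace_range B.subspace_M)
    finally have "(*v) c ` A.M \<subseteq> (*v) b ` A.M"
      using f_image_M_subset [of c b] b c LI by simp
    then have "(*v) c ` A.M = vec.span {u}"
      using sub b by simp
    then show ?thesis
      using that c uU by blast
  qed
qed

text \<open>The order on \<open>L\<close> is enough to carry subspaces \<open>W\<close> of
  \<open>A.U\<close> to subspaces \<open>\<phi> W\<close> of \<open>B.U\<close> in a strictly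
  monotone way, once two lines always lie in the image of a single element of
  \<open>L\<close>.\<close>

lemma dim_U_le:
  assumes dim: "vec.dim A.U + 2 \<le> vec.dim A.M"
  shows "vec.dim A.U \<le> vec.dim B.U"
proof -
  define \<phi> where "\<phi> W = (\<Union>a \<in> {a \<in> A.L. (*v) a ` A.M \<subseteq> W}. (*v) (f a) ` B.M)" for W
  \<comment> \<open>Every vector of \<open>\<phi> W\<close> comes from an element whose image of
    \<open>M\<close> is spanned by one vector of \<open>W\<close>.\<close>
  have \<phi>E: "\<exists>c u. c \<in> A.L \<and> u \<in> W \<and> (*v) c ` A.M = vec.span {u} \<and> (*v) (f c) ` B.M = vec.span {q}"
    if q: "q \<in> \<phi> W" for q W
  proof -
    obtain a where a: "a \<in> A.L" "(*v) a ` A.M \<subseteq> W" "q \<in> (*v) (f a) ` B.M"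
      using q unfolding \<phi>_def by blast
    then have "q \<in> B.U"
      using B.image_M_subset_U f_L LI by blast
    then obtain c u where c: "c \<in> A.L" "u \<in> A.U" "(*v) c ` A.M = vec.span {u}"
      "(*v) (f c) ` B.M = vec.span {q}"
      using rank_one_preimage by blast
    have "(*v) (f c) ` B.M \<subseteq> (*v) (f a) ` B.M"
      using a c by (simp add: span_singleton_subset subspace_range B.subspace_M)
    then have "(*v) c ` A.M \<subseteq> W"
      using f_image_M_subset [of c a] a c LI by blast
    then show ?thesis
      using c vec.span_base [of u "{u}"] by blast
  qed
  have \<phi>U: "\<phi> W \<subseteq> B.U" for W
    using B.image_M_subset_U f_L LI unfolding \<phi>_def by blast
  have sub: "vec.subspace (\<phi> W)" if W: "vec.subspace W" "W \<subseteq> A.U" for W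
  proof (rule vec.subspaceI)
    have "(*v) 0 ` A.M \<subseteq> W"
      using W vec.subspace_0 by auto
    moreover have "0 \<in> A.L"
      using A.zero_in_S A.subspace_U by (simp add: A.L_iff vec.subspace_0)
    moreover have "0 \<in> (*v) (f 0) ` B.M"
      by (simp add: subspace_range B.subspace_M vec.subspace_0)
    ultimately show "0 \<in> \<phi> W"
      unfolding \<phi>_def by blast
    fix p assume "p \<in> \<phi> W"
    then obtain a where a: "a \<in> A.L" "(*v) a ` A.M \<subseteq> W" "p \<in> (*v) (f a) ` B.M"
      unfolding \<phi>_def by blast
    then have "k *s p \<in> (*v) (f a) ` B.M" for k
      by (intro vec.subspace_scale subspace_range B.subspace_M)
    then show "k *s p \<in> \<phi> W" for k
      using a(1,2) unfolding \<phi>_def by (intro UN_I) auto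
    fix q assume "q \<in> \<phi> W"
    obtain c u where c: "c \<in> A.L" "u \<in> W" "(*v) c ` A.M = vec.span {u}" "(*v) (f c) ` B.M = vec.span {p}"
      using \<phi>E [OF \<open>p \<in> \<phi> W\<close>] by blast
    obtain d v where d: "d \<in> A.L" "v \<in> W" "(*v) d ` A.M = vec.span {v}" "(*v) (f d) ` B.M = vec.span {q}"
      using \<phi>E [OF \<open>q \<in> \<phi> W\<close>] by blast
    \<comment> \<open>The hypothesis on dimensions enters here: a common upper bound of
      \<open>c\<close> and \<open>d\<close> whose image is still inside \<open>W\<close>. The image
      of \<open>f a\<close> then contains both \<open>p\<close> and \<open>q\<close>.\<close>
    obtain a where a: "a \<in> A.L" "(*v) a ` A.M = vec.span {u, v}"
      using A.rank_two_in_L [OF dim, of u v] c(2) d(2) W(2) by blast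
    have "(*v) c ` A.M \<subseteq> (*v) a ` A.M" "(*v) d ` A.M \<subseteq> (*v) a ` A.M"
      unfolding a c d by (auto intro!: vec.span_mono)
    then have "vec.span {p} \<subseteq> (*v) (f a) ` B.M" "vec.span {q} \<subseteq> (*v) (f a) ` B.M"
      using f_image_M_subset a c d LI by metis+
    then have "p \<in> (*v) (f a) ` B.M" "q \<in> (*v) (f a) ` B.M"
      by (auto simp: vec.span_base)
    then have "p + q \<in> (*v) (f a) ` B.M"
      by (intro vec.subspace_add subspace_range B.subspace_M)
    moreover have "(*v) a ` A.M \<subseteq> W"
      using a c d W by (simp add: vec.span_minimal)
    ultimately show "p + q \<in> \<phi> W"
      using a unfolding \<phi>_def by blast
  qed
  have strict: "\<phi> W \<subset> \<phi> W'" if W: "vec.subspace W" "W \<subset> W'" "vec.subspace W'" "W' \<subseteq> A.U" for W W'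
  proof
    show "\<phi> W \<subseteq> \<phi> W'"
      using W unfolding \<phi>_def by blast
    obtain p where p: "p \<in> W'" "p \<notin> W"
      using W by blast
    obtain a where a: "a \<in> A.L" "(*v) a ` A.M = vec.span {p}"
      using A.rank_one_in_L p W by blast
    then have "(*v) a ` A.M \<subseteq> W'"
      using W p span_singleton_subset by blast
    then have fa: "(*v) (f a) ` B.M \<subseteq> \<phi> W'"
      using a unfolding \<phi>_def by blast
    have "p \<noteq> 0"
      using p W vec.subspace_0 by blast
    then have "p \<in> (*v) a ` A.M" "p \<notin> (*v) 0 ` A.M"
      using a by (auto simp: vec.span_base)
    then have "\<not> (*v) (f a) ` B.M \<subseteq> (*v) (f 0) ` B.M"
      using f_image_M_subset [of a 0] a LI A.zero_in_S by blast
    then obtain q where q: "q \<in> (*v) (f a) ` B.M" "q \<noteq> 0"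
      using B.subspace_M vec.subspace_0 by (force simp: image_iff f_zero)
    \<comment> \<open>Otherwise the line of \<open>q\<close> would come from some nonzero
      \<open>u\<close> in \<open>W\<close> that lies on the line of \<open>p\<close>, and so
      \<open>p\<close> would be in \<open>W\<close>.\<close>
    have "q \<notin> \<phi> W"
    proof
      assume "q \<in> \<phi> W"
      then obtain c u where c: "c \<in> A.L" "u \<in> W" "(*v) c ` A.M = vec.span {u}"
        "(*v) (f c) ` B.M = vec.span {q}"
        using \<phi>E [OF \<open>q \<in> \<phi> W\<close>] by blast
      have "(*v) (f c) ` B.M \<subseteq> (*v) (f a) ` B.M"
        using q c by (simp add: span_singleton_subset subspace_range B.subspace_M)
      then have ua: "vec.span {u} \<subseteq> vec.span {p}"
        using f_image_M_subset [of c a] a c LI by simp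
      have "u \<noteq> 0"
      proof
        assume "u = 0"
        then have "(*v) c ` A.M \<subseteq> (*v) 0 ` A.M"
          using c A.subspace_M vec.subspace_0 by auto
        then have "vec.span {q} \<subseteq> (*v) 0 ` B.M"
          using f_image_M_subset [of c 0] c LI A.zero_in_S f_zero by metis
        then show False
          using q vec.span_base [of q "{q}"] by auto
      qed
      then have "p \<in> vec.span {u}"
        using span_singleton_swap [of u p p] ua vec.span_base [of u "{u}"] vec.span_base [of p "{p}"]
        by blast
      then show False
        using p c W span_singleton_subset by blast
    qed
    then show "\<phi> W \<noteq> \<phi> W'"
      using q fa by blast
  qed
  have "vec.dim A.U + vec.dim (\<phi> {0}) \<le> vec.dim (\<phi> A.U) + vec.dim {0 :: 'a^'n}"
  proof (rule strict_mono_dim_le)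
    show "{0} \<subseteq> A.U"
      using A.subspace_U vec.subspace_0 by blast
  next
    fix W W' :: "('a ^ 'n) set"
    assume "vec.subspace W" "vec.subspace W'" "W \<subset> W'" "W' \<subseteq> A.U"
    then show "\<phi> W \<subset> \<phi> W'"
      by (intro strict)
  qed (simp_all add: sub A.subspace_U)
  also have "vec.dim (\<phi> A.U) \<le> vec.dim B.U"
    using \<phi>U by (rule vec.dim_subset)
  finally show ?thesis
    by simp
qed

lemma dim_U_eq_1_transfer: "vec.dim A.U = 1 \<Longrightarrow> vec.dim B.U = 1"
  unfolding A.dim_U_eq_1_iff B.dim_U_eq_1_iff
  by (metis L_cases LI f_image_M_subset f_zero A.zero_in_S)

lemma all_products_transfer:
  assumes "\<forall>x \<in> A.L \<inter> A.R. \<exists>a\<in>A.S. \<exists>b\<in>A.S. x = a ** b"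
  shows "\<forall>x \<in> B.L \<inter> B.R. \<exists>a\<in>B.S. \<exists>b\<in>B.S. x = a ** b"
proof
  fix x assume "x \<in> B.L \<inter> B.R"
  then obtain y where y: "y \<in> A.L \<inter> A.R" "x = f y"
    by (metis IntD1 IntD2 IntI L_cases LI f_R)
  then obtain a b where "a \<in> A.S" "b \<in> A.S" "y = a ** b"
    using assms by blast
  then show "\<exists>a\<in>B.S. \<exists>b\<in>B.S. x = a ** b"
    using y f_mult f_in by blast
qed

end

section \<open>Conjugate flags\<close>

text \<open>Extend a basis \<open>B\<close> of \<open>W\<close> and its image \<open>B'\<close> to
  bases of \<open>X\<close> and \<open>X'\<close>. Equal dimensions leave equally many new basis
  vectors on both sides, which are matched arbitrarily.\<close>

lemma extend_subspace_isomorphism: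
  fixes a :: "'a::field ^ 'n ^ 'n"
  assumes W: "vec.subspace W" "vec.subspace X" "W \<subseteq> X"
    and W': "vec.subspace W'" "vec.subspace X'" "W' \<subseteq> X'"
    and a: "inj_on ((*v) a) W" "(*v) a ` W = W'" and dim: "vec.dim X = vec.dim X'"
  obtains b :: "'a ^ 'n ^ 'n" where "inj_on ((*v) b) X" "(*v) b ` X = X'"
    "\<And>x. x \<in> W \<Longrightarrow> b *v x = a *v x"
proof -
  obtain B where B: "B \<subseteq> W" "vec.independent B" "vec.span B = W"
    using vec.basis_subspace_exists [OF W(1)] by metis
  obtain E where E: "B \<subseteq> E" "E \<subseteq> X" "vec.independent E" "X \<subseteq> vec.span E"
    using vec.maximal_independent_subset_extend [of B X] B W by blast
  define B' where "B' = (*v) a ` B"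
  have spB': "vec.span B' = W'"
    unfolding B'_def by (metis B(3) a(2) matrix_vector_mul_linear_gen vec.linear_span_image)
  have B': "vec.independent B'"
    unfolding B'_def using a(1) B
    by (intro vec.linear_independent_injective_image) auto
  have "B' \<subseteq> X'"
    using spB' W' vec.span_superset by blast
  then obtain E' where E': "B' \<subseteq> E'" "E' \<subseteq> X'" "vec.independent E'" "X' \<subseteq> vec.span E'"
    using vec.maximal_independent_subset_extend [of B' X'] B' by blast
  have fin: "finite E" "finite E'"
    using E E' vec.finiteI_independent by blast+
  have spE: "vec.span E = X" "vec.span E' = X'"
    using vec.span_subspace [OF E(2,4) W(2)] vec.span_subspace [OF E'(2,4) W'(2)] by blast+
  have "card E = card E'"
    using E E' dim spE by (metis vec.dim_span_eq_card_independent)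
  moreover have injB: "inj_on ((*v) a) B"
    using a B inj_on_subset by blast
  then have "card B = card B'"
    unfolding B'_def by (simp add: card_image)
  ultimately have "card (E - B) = card (E' - B')"
    using E E' fin by (metis card_Diff_subset finite_subset)
  then obtain h where h: "bij_betw h (E - B) (E' - B')"
    using fin by (metis finite_Diff finite_same_card_bij)
  have "bij_betw ((*v) a) B B'"
    using injB by (simp add: B'_def bij_betw_def)
  then have hh: "bij_betw (\<lambda>e. if e \<in> B then a *v e else h e) (B \<union> (E - B)) (B' \<union> (E' - B'))"
    using bij_betw_disjoint_Un [OF _ h, of "(*v) a" B B'] by blast
  obtain b :: "'a ^ 'n ^ 'n" where b: "\<And>e. e \<in> E \<Longrightarrow> b *v e = (if e \<in> B then a *v e else h e)"
    using linear_extension_matrix [OF E(3), of "\<lambda>e. if e \<in> B then a *v e else h e"] by blast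
  have "B \<union> (E - B) = E" "B' \<union> (E' - B') = E'"
    using E E' by auto
  then have "bij_betw (\<lambda>e. if e \<in> B then a *v e else h e) E E'"
    using hh by simp
  then have bE: "bij_betw ((*v) b) E E'"
    by (rule bij_betw_cong [THEN iffD1, rotated]) (simp add: b)
  have lin: "Vector_Spaces.linear (*s) (*s) ((*v) b)"
    by simp
  show thesis
  proof
    show "(*v) b ` X = X'"
      using bE spE vec.linear_span_image [OF lin, of E] by (simp add: bij_betw_def)
    show "inj_on ((*v) b) X"
      using bE spE E'(3) vec.linear_inj_on_span_iff_independent_image [OF lin, of E]
      by (simp add: bij_betw_def)
    fix x assume "x \<in> W"
    then have "x \<in> vec.span B"
      using B by blast
    moreover have "b *v e = a *v e" if "e \<in> B" for e
      using b [of e] that E(1) by auto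
    ultimately show "b *v x = a *v x"
      by (rule matrix_eq_on_span [rotated])
  qed
qed

text \<open>The matrix is built by extension from \<open>V i\<close> to \<open>V (Suc i)\<close>;
  each new matrix agrees with the old one on \<open>V i\<close>, so the images already fixed
  persist. At \<open>V r\<close> it is injective on the whole space.\<close>

lemma flag_conjugation:
  assumes "flag V r" "flag V' r" and dim: "\<And>i. i \<le> r \<Longrightarrow> vec.dim (V i) = vec.dim (V' i)"
  obtains b :: "'a::field ^ 'n ^ 'n" where "invertible b" "\<And>i. i \<le> r \<Longrightarrow> (*v) b ` V i = V' i"
proof -
  interpret A: flag V r by fact
  interpret B: flag V' r by fact
  have "\<exists>b :: 'a ^ 'n ^ 'n. inj_on ((*v) b) (V i) \<and> (\<forall>j\<le>i. (*v) b ` V j = V' j)" if "i \<le> r" for i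
    using that
  proof (induction i)
    case 0
    then show ?case
      by (auto simp: A.V_0 B.V_0)
  next
    case (Suc i)
    then obtain a :: "'a ^ 'n ^ 'n" where a: "inj_on ((*v) a) (V i)" "\<And>j. j \<le> i \<Longrightarrow> (*v) a ` V j = V' j"
      by auto
    have i: "i \<le> r" "Suc i \<le> r" "V i \<subseteq> V (Suc i)" "V' i \<subseteq> V' (Suc i)"
      using Suc.prems A.V_step [of i] B.V_step [of i] by auto
    obtain b :: "'a ^ 'n ^ 'n" where b: "inj_on ((*v) b) (V (Suc i))" "(*v) b ` V (Suc i) = V' (Suc i)"
      "\<And>x. x \<in> V i \<Longrightarrow> b *v x = a *v x"
      using extend_subspace_isomorphism [OF A.subspace_V [OF i(1)] A.subspace_V [OF i(2)] i(3)
          B.subspace_V [OF i(1)] B.subspace_V [OF i(2)] i(4) a(1) a(2) [OF order.refl] dim [OF i(2)]]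
      by blast
    have "(*v) b ` V j = V' j" if "j \<le> i" for j
    proof -
      have "V j \<subseteq> V i"
        using A.V_mono that i by blast
      then have "(*v) b ` V j = (*v) a ` V j"
        using b(3) by (intro image_cong) auto
      then show ?thesis
        using a that by simp
    qed
    then show ?case
      using b by (metis le_Suc_eq)
  qed
  from this [of r] obtain b :: "'a ^ 'n ^ 'n"
    where b: "inj ((*v) b)" "\<And>i. i \<le> r \<Longrightarrow> (*v) b ` V i = V' i"
    by (auto simp: A.V_r)
  then have "invertible b"
    by (metis matrix_left_invertible_injective invertible_left_inverse)
  then show thesis
    using b that by blast
qed

lemma conjugate_flag_iso:
  assumes "flag V r" "flag V' r" and "\<And>i. i \<le> r \<Longrightarrow> vec.dim (V i) = vec.dim (V' i)"
  shows "\<exists>f. flag_iso V V' r f"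
proof -
  interpret A: flag V r by fact
  interpret B: flag V' r by fact
  obtain b where b: "invertible b" "\<And>i. i \<le> r \<Longrightarrow> (*v) b ` V i = V' i"
    using flag_conjugation [OF assms] by blast
  then obtain c where c: "c ** b = mat 1" "b ** c = mat 1"
    unfolding invertible_def by blast
  have cb: "c *v (b *v x) = x" "b *v (c *v x) = x" for x
    by (simp_all add: matrix_vector_mul_assoc c)
  have bV: "b *v x \<in> V' i \<longleftrightarrow> x \<in> V i" if "i \<le> r" for i x
    using b(2) [OF that] cb by (metis imageE imageI)
  have conj: "b ** a ** c \<in> B.S \<longleftrightarrow> a \<in> A.S" for a
  proof -
    have "(\<forall>y\<in>V' (Suc i). (b ** a ** c) *v y \<in> V' i) \<longleftrightarrow> (\<forall>x\<in>V (Suc i). a *v x \<in> V i)" if "i < r" for i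
      using that b(2) [of "Suc i", symmetric]
      by (simp add: matrix_vector_mul_assoc [symmetric] cb bV)
    then show ?thesis
      by (simp add: A.S_def B.S_def)
  qed
  have undo: "b ** (c ** a ** b) ** c = a" "c ** (b ** a ** c) ** b = a" for a
    by (intro matrix_eqI, simp add: cb flip: matrix_vector_mul_assoc)+
  have mult: "b ** (x ** y) ** c = b ** x ** c ** (b ** y ** c)" for x y
    by (intro matrix_eqI) (simp add: cb flip: matrix_vector_mul_assoc)
  have "b ** a ** c \<in> B.S" if "a \<in> A.S" for a
    using that by (simp add: conj)
  moreover have "c ** a ** b \<in> A.S" if "a \<in> B.S" for a
    using that conj [of "c ** a ** b"] by (simp add: undo)
  ultimately have "bij_betw (\<lambda>a. b ** a ** c) A.S B.S"
    by (intro bij_betw_byWitness [where f' = "\<lambda>a. c ** a ** b"]) (auto simp: undo)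
  then have "flag_iso V V' r (\<lambda>a. b ** a ** c)"
    using mult by unfold_locales
  then show ?thesis
    by blast
qed

section \<open>Signature \<open>(k, 1, l)\<close> over an infinite field\<close>

lemma infinite_times_lepoll: "infinite A \<Longrightarrow> A \<times> A \<lesssim> A"
  using card_of_Times_same_infinite eqpoll_iff_card_of_ordIso eqpoll_imp_lepoll by blast

lemma vec_lepoll:
  assumes inf: "infinite (UNIV :: 'b set)"
  shows "(UNIV :: ('b ^ 'n) set) \<lesssim> (UNIV :: 'b set)"
proof -
  have "(I \<rightarrow>\<^sub>E (UNIV :: 'b set)) \<lesssim> (UNIV :: 'b set)" if "finite I" for I :: "'n set"
    using that
  proof induction
    case (insert i I)
    have "(insert i I \<rightarrow>\<^sub>E (UNIV :: 'b set)) \<lesssim> (UNIV :: 'b set) \<times> (I \<rightarrow>\<^sub>E (UNIV :: 'b set))"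
      unfolding PiE_insert_eq by (rule image_lepoll)
    also have "\<dots> \<lesssim> (UNIV :: 'b set) \<times> (UNIV :: 'b set)"
      using insert.IH by (intro times_lepoll_mono) auto
    also have "\<dots> \<lesssim> (UNIV :: 'b set)"
      using inf by (rule infinite_times_lepoll)
    finally show ?case .
  qed (simp add: singleton_lepoll lepoll_def)
  from this [of UNIV] have "(UNIV :: ('n \<Rightarrow> 'b) set) \<lesssim> (UNIV :: 'b set)"
    by (simp add: PiE_UNIV_domain)
  moreover have "(UNIV :: ('b ^ 'n) set) \<lesssim> (UNIV :: ('n \<Rightarrow> 'b) set)"
    by (rule subset_image_lepoll [of _ vec_lambda]) (metis subsetI rangeI vec_lambda_eta)
  ultimately show ?thesis
    using lepoll_trans by blast
qed

lemma matrices_lepoll: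
  assumes inf: "infinite (UNIV :: 'b set)"
  shows "(X :: ('b ^ 'n ^ 'm) set) \<lesssim> (UNIV :: 'b set)"
proof -
  have "inj (\<lambda>x :: 'b. (\<chi> i. x) :: 'b ^ 'n)"
    by (auto simp: inj_on_def vec_eq_iff)
  then have "infinite (UNIV :: ('b ^ 'n) set)"
    using inf by (metis finite_image_iff finite_subset subset_UNIV)
  then have "(UNIV :: ('b ^ 'n ^ 'm) set) \<lesssim> (UNIV :: 'b set)"
    by (rule lepoll_trans [OF vec_lepoll vec_lepoll [OF inf]])
  then show ?thesis
    by (rule lepoll_trans [OF subset_imp_lepoll [OF subset_UNIV]])
qed

section \<open>Projective spaces and homogeneous bijections\<close>

definition lines :: "('a::field ^ 'n) set \<Rightarrow> ('a ^ 'n) set set" where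
  "lines X = (\<lambda>x. vec.span {x}) ` (X - {0})"

lemma span_scale_singleton: "c \<noteq> 0 \<Longrightarrow> vec.span {c *s x} = vec.span {x}"
  for x :: "'a::field ^ 'n"
  using vec.span_image_scale [of "{x}" "\<lambda>_. c"] by simp

text \<open>There are at most as many lines as vectors, and a finite power of an infinite field has
  the size of the field. Conversely the lines through \<open>v - c *s u\<close> are distinct for
  distinct \<open>c\<close>.\<close>

lemma lines_eqpoll:
  fixes X :: "('a::field ^ 'n) set"
  assumes inf: "infinite (UNIV :: 'a set)" and X: "vec.subspace X"
    and uv: "u \<in> X" "u \<noteq> 0" "v \<in> X" "v \<notin> vec.span {u}"
  shows "lines X \<approx> (UNIV :: 'a set)"
proof (rule lepoll_antisym)
  have "lines X \<lesssim> X - {0}"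
    unfolding lines_def by (rule image_lepoll)
  also have "\<dots> \<lesssim> (UNIV :: ('a ^ 'n) set)"
    by (rule subset_imp_lepoll) simp
  also have "\<dots> \<lesssim> (UNIV :: 'a set)"
    by (rule vec_lepoll [OF inf])
  finally show "lines X \<lesssim> (UNIV :: 'a set)" .
  have v0: "v - c *s u \<noteq> 0" for c
    using uv by (auto simp: vec.span_singleton)
  have "inj (\<lambda>c. vec.span {v - c *s u})"
  proof (rule injI)
    fix s t assume "vec.span {v - s *s u} = vec.span {v - t *s u}"
    then have "v - s *s u \<in> vec.span {v - t *s u}"
      using vec.span_base by blast
    then obtain k where k: "v - s *s u = k *s (v - t *s u)"
      by (auto simp: vec.span_singleton)
    then have *: "(1 - k) *s v = (s - k * t) *s u"
      by (simp add: vec.scale_left_diff_distrib vec.scale_right_diff_distrib algebra_simps)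
    have "k = 1"
    proof (rule ccontr)
      assume "k \<noteq> 1"
      then have "v = inverse (1 - k) *s ((1 - k) *s v)"
        unfolding vec.scale_scale using \<open>k \<noteq> 1\<close> by simp
      then have "v = (inverse (1 - k) * (s - k * t)) *s u"
        by (simp only: * vec.scale_scale)
      then show False
        using uv by (auto simp: vec.span_singleton)
    qed
    then show "s = t"
      using * uv by simp
  qed
  moreover have "v - c *s u \<in> X - {0}" for c
    using v0 uv X by (simp add: vec.subspace_diff vec.subspace_scale)
  then have "range (\<lambda>c. vec.span {v - c *s u}) \<subseteq> lines X"
    by (auto simp: lines_def)
  ultimately show "(UNIV :: 'a set) \<lesssim> lines X"
    unfolding lepoll_def by blast
qed

text \<open>Only homogeneity is asked for: a set-theoretic bijection of the lines, lifted by choosing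
  a representative on every line.\<close>

lemma homogeneous_bijection:
  fixes X Y :: "('a::field ^ 'n) set"
  assumes "vec.subspace X" "vec.subspace Y" "lines X \<approx> lines Y"
  obtains g where "bij_betw g X Y" "\<And>c x. x \<in> X \<Longrightarrow> g (c *s x) = c *s g x"
proof -
  obtain h where h: "bij_betw h (lines X) (lines Y)"
    using assms unfolding eqpoll_def by blast
  \<comment> \<open>\<open>\<rho>\<close> chooses a nonzero vector on each line and
    \<open>\<kappa>\<close> is the coordinate with respect to it. The map \<open>g\<close> keeps the
    coordinate and moves the line by \<open>h\<close>; zero, which lies on no unique line, is
    treated apart.\<close>
  define \<rho> :: "('a ^ 'n) set \<Rightarrow> 'a ^ 'n" where "\<rho> l = (SOME x. x \<noteq> 0 \<and> vec.span {x} = l)" for l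
  have \<rho>: "\<rho> l \<noteq> 0 \<and> vec.span {\<rho> l} = l" if "l \<in> lines Z" for l Z
    unfolding \<rho>_def by (rule someI_ex) (use that in \<open>auto simp: lines_def\<close>)
  have \<rho>_in: "\<rho> l \<in> Z" if l: "l \<in> lines Z" "vec.subspace Z" for l Z
  proof -
    obtain x where "x \<in> Z" "l = vec.span {x}"
      using l unfolding lines_def by blast
    then show ?thesis
      using \<rho> [OF l(1)] span_singleton_subset [OF l(2)] vec.span_base [of "\<rho> l" "{\<rho> l}"] by blast
  qed
  define \<kappa> where "\<kappa> x = (SOME c. x = c *s \<rho> (vec.span {x}))" for x
  have line: "vec.span {x} \<in> lines Z" if "x \<in> Z" "x \<noteq> 0" for x and Z :: "('a ^ 'n) set"
    using that by (auto simp: lines_def)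
  have \<kappa>: "x = \<kappa> x *s \<rho> (vec.span {x})" if "x \<noteq> 0" for x
    unfolding \<kappa>_def
  proof (rule someI_ex)
    have "x \<in> vec.span {\<rho> (vec.span {x})}"
      using \<rho> [OF line [of x UNIV]] that by (simp add: vec.span_base)
    then show "\<exists>c. x = c *s \<rho> (vec.span {x})"
      by (auto simp: vec.span_singleton)
  qed
  have \<kappa>_unique: "\<kappa> (c *s \<rho> l) = c" if "c \<noteq> 0" "l \<in> lines Z" for c l Z
  proof -
    have "vec.span {c *s \<rho> l} = l"
      using \<rho> [OF that(2)] that(1) by (simp add: span_scale_singleton)
    then show ?thesis
      using \<kappa> [of "c *s \<rho> l"] \<rho> [OF that(2)] that(1) by simp
  qed
  define g where "g x = (if x = 0 then 0 else \<kappa> x *s \<rho> (h (vec.span {x})))" for x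
  have hin: "h l \<in> lines Y" if "l \<in> lines X" for l
    using h that bij_betwE by blast
  have g: "g (c *s \<rho> l) = c *s \<rho> (h l)" if "l \<in> lines X" for c l
  proof (cases "c = 0")
    case False
    then show ?thesis
      using \<rho> [OF that] \<kappa>_unique [OF False that] by (simp add: g_def span_scale_singleton)
  qed (simp add: g_def)
  have decomp: "\<exists>c. \<exists>l\<in>lines Z. x = c *s \<rho> l" if "x \<in> Z" "x \<noteq> 0" for x Z
    using \<kappa> line that by blast
  show thesis
  proof
    show hom: "g (c *s x) = c *s g x" if x: "x \<in> X" for c x
    proof (cases "x = 0")
      case False
      then obtain d l where "l \<in> lines X" "x = d *s \<rho> l"
        using decomp [OF x False] by blast
      then show ?thesis
        using g [of l] by (simp add: vec.scale_scale)
    qed (simp add: g_def)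
    show "bij_betw g X Y"
    proof (rule bij_betw_imageI)
      have nz: "g x \<noteq> 0" "vec.span {g x} = h (vec.span {x})" if x: "x \<in> X" "x \<noteq> 0" for x
      proof -
        obtain c l where cl: "l \<in> lines X" "x = c *s \<rho> l"
          using decomp [OF x] by blast
        then have "c \<noteq> 0"
          using x by auto
        then show "g x \<noteq> 0" "vec.span {g x} = h (vec.span {x})"
          using cl g [of l c] \<rho> [OF cl(1)] \<rho> [OF hin [OF cl(1)]] by (simp_all add: span_scale_singleton)
      qed
      show "inj_on g X"
      proof (rule inj_onI)
        fix x y assume xy: "x \<in> X" "y \<in> X" "g x = g y"
        show "x = y"
        proof (cases "x = 0 \<or> y = 0")
          case True
          have "g 0 = 0"
            by (simp add: g_def)
          then show ?thesis
            using nz xy True by metis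
        next
          case False
          then have "h (vec.span {x}) = h (vec.span {y})"
            using nz xy by metis
          then have eq: "vec.span {x} = vec.span {y}"
            using h line xy False unfolding bij_betw_def inj_on_def by blast
          have l: "h (vec.span {x}) \<in> lines Y"
            using hin line xy False by blast
          have "\<kappa> x = \<kappa> y"
            using xy(3) False \<rho> [OF l] by (simp add: g_def eq)
          then show ?thesis
            using \<kappa> False eq by metis
        qed
      qed
      show "g ` X = Y"
      proof (intro equalityI subsetI)
        fix y assume "y \<in> g ` X"
        then obtain x where x: "x \<in> X" "y = g x"
          by blast
        show "y \<in> Y"
        proof (cases "x = 0")
          case True
          then show ?thesis
            using x assms(2) by (simp add: g_def vec.subspace_0)
        next
          case False
          then show ?thesis
            using x \<rho>_in [OF hin [OF line [OF x(1) False]] assms(2)] assms(2)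
            by (simp add: g_def vec.subspace_scale)
        qed
      next
        fix y assume y: "y \<in> Y"
        show "y \<in> g ` X"
        proof (cases "y = 0")
          case True
          then show ?thesis
            using assms(1) by (auto simp: g_def vec.subspace_0 image_iff intro!: bexI [of _ 0])
        next
          case False
          then obtain c l where cl: "l \<in> lines Y" "y = c *s \<rho> l"
            using decomp [OF y False] by blast
          then obtain l' where l': "l' \<in> lines X" "l = h l'"
            using h unfolding bij_betw_def by blast
          have "y = g (c *s \<rho> l')"
            using g [OF l'(1)] cl l' by simp
          moreover have "c *s \<rho> l' \<in> X"
            using \<rho>_in [OF l'(1)] assms(1) by (simp add: vec.subspace_scale)
          ultimately show ?thesis
            by blast
        qed
      qed
    qed
  qed
qed

text \<open>Bijections chosen fibre by fibre are glued; as \<open>k\<close> is a bijection of the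
  bases, images of distinct fibres are disjoint and exhaust \<open>B\<close>.\<close>

lemma fibrewise_bijection:
  assumes k: "bij_betw k P Q" and "\<phi> ` A \<subseteq> P" "\<psi> ` B \<subseteq> Q"
    and eq: "\<And>p. p \<in> P \<Longrightarrow> {a \<in> A. \<phi> a = p} \<approx> {b \<in> B. \<psi> b = k p}"
  obtains F where "bij_betw F A B" "\<And>a. a \<in> A \<Longrightarrow> \<psi> (F a) = k (\<phi> a)"
proof -
  have "\<forall>p\<in>P. \<exists>F. bij_betw F {a \<in> A. \<phi> a = p} {b \<in> B. \<psi> b = k p}"
    using eq unfolding eqpoll_def by blast
  then obtain F where F: "\<And>p. p \<in> P \<Longrightarrow> bij_betw (F p) {a \<in> A. \<phi> a = p} {b \<in> B. \<psi> b = k p}"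
    by metis
  define G where "G a = F (\<phi> a) a" for a
  have G: "G a \<in> B" "\<psi> (G a) = k (\<phi> a)" if "a \<in> A" for a
  proof -
    have "\<phi> a \<in> P"
      using assms that by blast
    from bij_betwE [OF F [OF this]] show "G a \<in> B" "\<psi> (G a) = k (\<phi> a)"
      using that by (auto simp: G_def)
  qed
  have "bij_betw G A B"
  proof (rule bij_betw_imageI)
    show "inj_on G A"
    proof (rule inj_onI)
      fix x y assume xy: "x \<in> A" "y \<in> A" "G x = G y"
      then have "k (\<phi> x) = k (\<phi> y)"
        using G by metis
      moreover have P: "\<phi> x \<in> P" "\<phi> y \<in> P"
        using assms xy by blast+
      ultimately have "\<phi> x = \<phi> y"
        using k unfolding bij_betw_def inj_on_def by blast
      then show "x = y"
        using F [OF P(1)] xy unfolding bij_betw_def inj_on_def G_def by simp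
    qed
    show "G ` A = B"
    proof (intro equalityI subsetI)
      fix b assume b: "b \<in> B"
      then obtain p where p: "p \<in> P" "\<psi> b = k p"
        using k assms(3) unfolding bij_betw_def by blast
      then have "b \<in> F p ` {a \<in> A. \<phi> a = p}"
        using F [OF p(1)] b unfolding bij_betw_def by blast
      then show "b \<in> G ` A"
        by (auto simp: G_def)
    qed (use G in blast)
  qed
  then show thesis
    using that G by blast
qed

lemma outer_eq_outer_iff:
  "outer u y = outer u' y' \<longleftrightarrow>
    (u = 0 \<or> y = 0) \<and> (u' = 0 \<or> y' = 0) \<or> (\<exists>c. c \<noteq> 0 \<and> u' = c *s u \<and> y = c *s y')"
proof
  assume eq: "outer u y = outer u' y'"
  have zero: "outer a b = 0 \<longleftrightarrow> a = 0 \<or> b = 0" for a b :: "'a ^ 'b"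
    by (auto simp: outer_def vec_eq_iff)
  show "(u = 0 \<or> y = 0) \<and> (u' = 0 \<or> y' = 0) \<or> (\<exists>c. c \<noteq> 0 \<and> u' = c *s u \<and> y = c *s y')"
  proof (cases "u = 0 \<or> y = 0")
    case True
    then show ?thesis
      using zero eq by metis
  next
    case False
    then have nz: "u' \<noteq> 0" "y' \<noteq> 0"
      using zero eq by metis+
    obtain i where i: "y $ i \<noteq> 0"
      using False by (auto simp: vec_eq_iff)
    obtain j where j: "u $ j \<noteq> 0"
      using False by (auto simp: vec_eq_iff)
    have ent: "u $ p * y $ q = u' $ p * y' $ q" for p q
      using eq by (simp add: outer_def vec_eq_iff)
    have nz': "y' $ i \<noteq> 0" "u' $ j \<noteq> 0"
      using ent [of j i] i j by auto
    \<comment> \<open>The entries in column \<open>i\<close> force the ratio of \<open>u'\<close> to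
      \<open>u\<close>; the entries in row \<open>j\<close> then give the same ratio for
      \<open>y\<close> to \<open>y'\<close>.\<close>
    define c where "c = y $ i / y' $ i"
    have "u' = c *s u"
      using ent [of _ i] nz' by (simp add: c_def vec_eq_iff field_simps)
    moreover have "c \<noteq> 0"
      using i nz' by (simp add: c_def)
    moreover have "y = c *s y'"
    proof -
      have "u $ j * y $ q = u $ j * (c * y' $ q)" for q
        using ent [of j q] \<open>u' = c *s u\<close> by simp
      then show ?thesis
        using j by (simp add: vec_eq_iff)
    qed
    ultimately show ?thesis
      by blast
  qed
next
  assume "(u = 0 \<or> y = 0) \<and> (u' = 0 \<or> y' = 0) \<or> (\<exists>c. c \<noteq> 0 \<and> u' = c *s u \<and> y = c *s y')"
  then show "outer u y = outer u' y'"
    by (auto simp: outer_def vec_eq_iff)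
qed

text \<open>The criterion \<open>outer_eq_outer_iff\<close> mentions only zero and scalar multiples,
  and homogeneous bijections preserve both.\<close>

lemma outer_homogeneous_iff:
  assumes g: "bij_betw g X X'" "\<And>c x. x \<in> X \<Longrightarrow> g (c *s x) = c *s g x" "vec.subspace X"
    and h: "bij_betw h Y Y'" "\<And>c x. x \<in> Y \<Longrightarrow> h (c *s x) = c *s h x" "vec.subspace Y"
    and u: "u \<in> X" "u' \<in> X" "y \<in> Y" "y' \<in> Y"
  shows "outer (g u) (h y) = outer (g u') (h y') \<longleftrightarrow> outer u y = outer u' y'"
proof -
  have g_eq: "g a = c *s g b \<longleftrightarrow> a = c *s b" if "a \<in> X" "b \<in> X" for a b c
    using g that by (metis bij_betw_def inj_on_eq_iff vec.subspace_scale)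
  have h_eq: "h a = c *s h b \<longleftrightarrow> a = c *s b" if "a \<in> Y" "b \<in> Y" for a b c
    using h that by (metis bij_betw_def inj_on_eq_iff vec.subspace_scale)
  have "g a = 0 \<longleftrightarrow> a = 0" if "a \<in> X" for a
    using g_eq [OF that that, of 0] by simp
  moreover have "h a = 0 \<longleftrightarrow> a = 0" if "a \<in> Y" for a
    using h_eq [OF that that, of 0] by simp
  ultimately show ?thesis
    unfolding outer_eq_outer_iff using u g_eq h_eq by simp
qed

section \<open>Products and their fibres for signature \<open>(k, 1, l)\<close> with
  \<open>k, l > 1\<close>\<close>

locale flag_k1l = flag V 3
  for V :: "nat \<Rightarrow> ('a::field ^ 'n) set" +
  fixes w \<eta> :: "'a ^ 'n"
  assumes w: "w \<in> M" and \<eta>_U: "\<And>u. u \<in> U \<Longrightarrow> dotp \<eta> u = 0" and \<eta>_w: "dotp \<eta> w = 1"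
    and dim_M: "vec.dim M = Suc (vec.dim U)" and dim_U: "2 \<le> vec.dim U"
    and codim_M: "vec.dim M + 2 \<le> CARD('n)"
begin

text \<open>The annihilator of \<open>M\<close>, that is, the dual of the quotient by
  \<open>M\<close>.\<close>

definition \<Gamma> :: "('a ^ 'n) set" where
  "\<Gamma> = {y. \<forall>x\<in>M. dotp y x = 0}"

text \<open>The functional that assigns to \<open>x\<close> the coefficient of \<open>w\<close> in
  \<open>a *v x\<close> modulo \<open>U\<close>, for \<open>a\<close> in \<open>S\<close>. With
  \<open>a *v w\<close> it is all that multiplication sees of \<open>a\<close>.\<close>

definition \<gamma> :: "'a ^ 'n ^ 'n \<Rightarrow> 'a ^ 'n" where
  "\<gamma> a = \<eta> v* a"

text \<open>By \<open>product_eq_outer\<close> and \<open>D_product\<close> this is the set of all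
  products in \<open>S\<close>.\<close>

definition D :: "('a ^ 'n ^ 'n) set" where
  "D = (\<lambda>(u, y). outer u y) ` (U \<times> \<Gamma>)"

lemma subspace_\<Gamma>: "vec.subspace \<Gamma>"
  by (auto simp: \<Gamma>_def vec.subspace_def dotp_add_left dotp_scale_left)

lemma M_eq: "M = V 2"
  by (simp add: M_def)

lemma mult_w_in_U: "a \<in> S \<Longrightarrow> x \<in> M \<Longrightarrow> a *v x \<in> U"
  using mult_vec_in_V [of a 1 x] by (simp add: M_eq U_def numeral_2_eq_2)

lemma \<gamma>_in_\<Gamma>: "a \<in> S \<Longrightarrow> \<gamma> a \<in> \<Gamma>"
  using mult_w_in_U \<eta>_U by (auto simp: \<Gamma>_def \<gamma>_def dotp_vector_matrix)

lemma w_notin_U: "w \<notin> U"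
  using \<eta>_U \<eta>_w by force

text \<open>Modulo \<open>U\<close>, which \<open>a\<close> kills, \<open>b *v x\<close> equals
  \<open>k *s w\<close>, and \<open>\<eta>\<close> reads off \<open>k\<close>.\<close>

lemma product_eq_outer:
  assumes "a \<in> S" "b \<in> S"
  shows "a ** b = outer (a *v w) (\<gamma> b)"
proof (rule matrix_eqI)
  fix x
  have "b *v x \<in> vec.span (insert w U)"
    using M_eq_span_insert [OF dim_M w w_notin_U] mult_vec_in_M assms by blast
  then obtain k where k: "b *v x - k *s w \<in> U"
    using subspace_U by (metis vec.span_breakdown_eq vec.span_eq_iff)
  then have "a *v (b *v x - k *s w) = 0"
    using mult_U_eq_0 assms by blast
  then have "(a ** b) *v x = k *s (a *v w)"
    by (simp add: matrix_vector_mul_assoc [symmetric] vec.diff vec.scale)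
  moreover have "dotp \<eta> (b *v x) = k"
    using \<eta>_U [OF k] dotp_add_right [of \<eta> "b *v x - k *s w" "k *s w"]
    by (simp add: dotp_scale_right \<eta>_w)
  ultimately show "(a ** b) *v x = outer (a *v w) (\<gamma> b) *v x"
    by (simp add: outer_mult_vec \<gamma>_def dotp_vector_matrix)
qed

lemma outer_L: "u \<in> U \<Longrightarrow> outer u \<eta> \<in> S"
  using outer_in_L \<eta>_U L_subset_S by blast

lemma outer_R: "x \<in> M \<Longrightarrow> y \<in> \<Gamma> \<Longrightarrow> outer x y \<in> S"
  using outer_in_R [of x y] R_subset_S by (auto simp: \<Gamma>_def)

lemma \<gamma>_add: "\<gamma> (a + b) = \<gamma> a + \<gamma> b"
  by (simp add: \<gamma>_def vector_matrix_mult_def vec_eq_iff algebra_simps sum.distrib)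

lemma \<gamma>_outer: "\<gamma> (outer u y) = dotp \<eta> u *s y"
  by (rule dotp_eqI) (simp add: \<gamma>_def dotp_vector_matrix outer_mult_vec dotp_scale_left dotp_scale_right)

lemma D_subset_S: "D \<subseteq> S"
  using outer_R U_psubset_M by (auto simp: D_def)

lemma D_zero: "a \<in> D \<Longrightarrow> a *v w = 0 \<and> \<gamma> a = 0"
  using w \<eta>_U by (auto simp: D_def outer_mult_vec \<Gamma>_def \<gamma>_outer)

lemma D_product:
  assumes "a \<in> D"
  shows "\<exists>b\<in>S. \<exists>c\<in>S. a = b ** c"
proof -
  obtain u y where "u \<in> U" "y \<in> \<Gamma>" "a = outer u y"
    using assms by (auto simp: D_def)
  then show ?thesis
    using outer_L [of u] outer_R [OF w, of y]
    by (intro bexI [of _ "outer u \<eta>"] bexI [of _ "outer w y"]) (auto simp: mult_outer outer_mult_vec \<eta>_w)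
qed

text \<open>In every fibre of \<open>a \<mapsto> (a w, \<gamma> a)\<close> outside \<open>D\<close> there is an affine line:
  perturb one element by matrices of rank two that annihilate \<open>M\<close> and map into \<open>U\<close>.\<close>

lemma fibre_eqpoll:
  assumes inf: "infinite (UNIV :: 'a set)" and uy: "u \<in> U" "y \<in> \<Gamma>"
  shows "{a \<in> S - D. (a *v w, \<gamma> a) = (u, y)} \<approx> (UNIV :: 'a set)"
proof (rule lepoll_antisym)
  show "{a \<in> S - D. (a *v w, \<gamma> a) = (u, y)} \<lesssim> (UNIV :: 'a set)"
    by (rule matrices_lepoll [OF inf])
  obtain u1 u2 where u12: "u1 \<in> U" "u1 \<noteq> 0" "u2 \<in> U" "u2 \<notin> vec.span {u1}"
    using two_independent [OF dim_U] by blast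
  obtain z1 z2 e1 e2 where z: "\<And>x. x \<in> M \<Longrightarrow> dotp z1 x = 0" "\<And>x. x \<in> M \<Longrightarrow> dotp z2 x = 0"
    "dotp z1 e1 = 1" "dotp z2 e1 = 0" "dotp z2 e2 = 1"
    using two_functionals_on_M [OF codim_M] by blast
  have z\<Gamma>: "z1 \<in> \<Gamma>" "z2 \<in> \<Gamma>"
    using z by (auto simp: \<Gamma>_def)
  define x where "x t = outer u1 (z1 + t *s z2) + outer u2 z2" for t
  \<comment> \<open>\<open>outer u \<eta>\<close> contributes \<open>u\<close> at \<open>w\<close>
    and \<open>outer w y\<close> contributes \<open>y\<close> to \<open>\<gamma>\<close>; adding
    \<open>x t\<close> changes neither.\<close>
  define a where "a t = (outer u \<eta> + outer w y) + x t" for t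
  have x\<Gamma>: "z1 + t *s z2 \<in> \<Gamma>" for t
    using z\<Gamma> subspace_\<Gamma> by (simp add: vec.subspace_add vec.subspace_scale)
  have u12M: "u1 \<in> M" "u2 \<in> M"
    using u12 U_psubset_M by blast+
  have xS: "x t \<in> S" for t
    unfolding x_def using u12M x\<Gamma> z\<Gamma> by (intro add_in_S outer_R)
  have x0: "x t *v w = 0" "\<gamma> (x t) = 0" for t
    using z w \<eta>_U u12
    by (simp_all add: x_def matrix_vector_mult_add_rdistrib outer_mult_vec dotp_add_left dotp_scale_left \<gamma>_add \<gamma>_outer)
  have aS: "a t \<in> S" for t
    unfolding a_def using uy w xS by (intro add_in_S outer_R outer_L)
  have a_eq: "a t *v w = u" "\<gamma> (a t) = y" for t
    using uy w
    by (simp_all add: a_def x0 matrix_vector_mult_add_rdistrib outer_mult_vec \<eta>_w \<gamma>_add \<gamma>_outer \<eta>_U \<Gamma>_def)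
  \<comment> \<open>Only the fibre over \<open>(0, 0)\<close> meets \<open>D\<close>, and there
    \<open>a t = x t\<close> has rank two and is no product.\<close>
  have "a t \<notin> D" for t
  proof
    assume aD: "a t \<in> D"
    then have "u = 0" "y = 0"
      using D_zero a_eq by metis+
    then have "a t = x t"
      by (simp add: a_def outer_def vec_eq_iff)
    then obtain b c where "b \<in> S" "c \<in> S" "x t = b ** c"
      using D_product [OF aD] by auto
    moreover have "dotp (z1 + t *s z2) e1 = 1"
      using z by (simp add: dotp_add_left dotp_scale_left)
    ultimately show False
      using sum_outer_not_product [OF dim_M _ _ u12(2,4), of b c "z1 + t *s z2" e1 z2 e2] z
      unfolding x_def by blast
  qed
  moreover have "inj a"
  proof (rule injI)
    fix s t assume "a s = a t"
    then have "x s *v e2 = x t *v e2"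
      by (simp add: a_def)
    then have "(dotp z1 e2 + s) *s u1 = (dotp z1 e2 + t) *s u1"
      using z by (simp add: x_def matrix_vector_mult_add_rdistrib outer_mult_vec dotp_add_left dotp_scale_left)
    then show "s = t"
      using u12 by simp
  qed
  ultimately show "(UNIV :: 'a set) \<lesssim> {a \<in> S - D. (a *v w, \<gamma> a) = (u, y)}"
    unfolding lepoll_def using aS a_eq by (intro exI [of _ a]) auto
qed

lemma lines_U_eqpoll:
  assumes "infinite (UNIV :: 'a set)"
  shows "lines U \<approx> (UNIV :: 'a set)"
proof -
  obtain u v where "u \<in> U" "u \<noteq> 0" "v \<in> U" "v \<notin> vec.span {u}"
    using two_independent [OF dim_U] by blast
  then show ?thesis
    by (rule lines_eqpoll [OF assms subspace_U])
qed

lemma lines_\<Gamma>_eqpoll: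
  assumes "infinite (UNIV :: 'a set)"
  shows "lines \<Gamma> \<approx> (UNIV :: 'a set)"
proof -
  obtain z1 z2 e1 e2 where z: "\<And>x. x \<in> M \<Longrightarrow> dotp z1 x = 0" "\<And>x. x \<in> M \<Longrightarrow> dotp z2 x = 0"
    "dotp z1 e1 = 1" "dotp z2 e1 = 0" "dotp z2 e2 = 1"
    using two_functionals_on_M [OF codim_M] by blast
  have "z1 \<notin> vec.span {z2}"
    using z by (auto simp: vec.span_singleton dotp_scale_left)
  moreover have "z2 \<noteq> 0" "z1 \<in> \<Gamma>" "z2 \<in> \<Gamma>"
    using z by (auto simp: \<Gamma>_def)
  ultimately show ?thesis
    using lines_eqpoll [OF assms subspace_\<Gamma>] by blast
qed

end

text \<open>The isomorphism sends \<open>outer u y\<close> in \<open>D\<close> to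
  \<open>outer (g u) (h y)\<close>, and outside \<open>D\<close> it is any bijection that carries
  the fibre over \<open>(u, y)\<close> to the fibre over \<open>(g u, h y)\<close>. Since products
  depend only on these data, it is multiplicative.\<close>

lemma flag_iso_k1l:
  fixes V V' :: "nat \<Rightarrow> ('a::field ^ 'n) set"
  assumes inf: "infinite (UNIV :: 'a set)" and "flag_k1l V w \<eta>" "flag_k1l V' w' \<eta>'"
  shows "\<exists>f. flag_iso V V' 3 f"
proof -
  interpret A: flag_k1l V w \<eta> by fact
  interpret B: flag_k1l V' w' \<eta>' by fact
  have "lines A.U \<approx> lines B.U" "lines A.\<Gamma> \<approx> lines B.\<Gamma>"
    using A.lines_U_eqpoll [OF inf] B.lines_U_eqpoll [OF inf]
      A.lines_\<Gamma>_eqpoll [OF inf] B.lines_\<Gamma>_eqpoll [OF inf] eqpoll_sym eqpoll_trans by blast+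
  then obtain g h where g: "bij_betw g A.U B.U" "\<And>c x. x \<in> A.U \<Longrightarrow> g (c *s x) = c *s g x"
    and h: "bij_betw h A.\<Gamma> B.\<Gamma>" "\<And>c x. x \<in> A.\<Gamma> \<Longrightarrow> h (c *s x) = c *s h x"
    using homogeneous_bijection [OF A.subspace_U B.subspace_U]
      homogeneous_bijection [OF A.subspace_\<Gamma> B.subspace_\<Gamma>] by metis
  have zero: "g 0 = 0" "h 0 = 0"
    using g(2) [of 0 0] h(2) [of 0 0] A.subspace_U A.subspace_\<Gamma> by (auto simp: vec.subspace_0)
  have outer: "outer (g u) (h y) = outer (g u') (h y') \<longleftrightarrow> outer u y = outer u' y'"
    if "u \<in> A.U" "u' \<in> A.U" "y \<in> A.\<Gamma>" "y' \<in> A.\<Gamma>" for u u' y y'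
    using outer_homogeneous_iff [OF g A.subspace_U h A.subspace_\<Gamma>] that by blast
  define k where "k = (\<lambda>(u, y). (g u, h y))"
  have k: "bij_betw k (A.U \<times> A.\<Gamma>) (B.U \<times> B.\<Gamma>)"
    unfolding k_def using bij_betw_map_prod [OF g(1) h(1)] by (simp add: map_prod_def)
  \<comment> \<open>A chosen factorisation of an outer product; \<open>outer\<close> makes the value
    of \<open>G\<close> independent of the choice.\<close>
  define pick where "pick a = (SOME p. p \<in> A.U \<times> A.\<Gamma> \<and> a = outer (fst p) (snd p))" for a
  define G where "G a = outer (g (fst (pick a))) (h (snd (pick a)))" for a
  have G: "G (outer u y) = outer (g u) (h y)" if "u \<in> A.U" "y \<in> A.\<Gamma>" for u y
  proof -
    have "pick (outer u y) \<in> A.U \<times> A.\<Gamma> \<and> outer u y = outer (fst (pick (outer u y))) (snd (pick (outer u y)))"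
      unfolding pick_def by (rule someI [of _ "(u, y)"]) (use that in simp)
    then show ?thesis
      unfolding G_def using outer that by (metis mem_Times_iff)
  qed
  have GD: "bij_betw G A.D B.D"
  proof (rule bij_betw_imageI)
    show "inj_on G A.D"
      by (rule inj_onI) (auto simp: A.D_def G outer)
    have "B.D = (\<lambda>(u, y). outer u y) ` k ` (A.U \<times> A.\<Gamma>)"
      using k by (simp add: B.D_def bij_betw_def)
    then show "G ` A.D = B.D"
      by (force simp: A.D_def k_def G image_iff)
  qed
  have fib: "{a \<in> A.S - A.D. (a *v w, A.\<gamma> a) = p} \<approx> {b \<in> B.S - B.D. (b *v w', B.\<gamma> b) = k p}"
    if p: "p \<in> A.U \<times> A.\<Gamma>" for p
  proof -
    have kp: "k p \<in> B.U \<times> B.\<Gamma>"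
      using k p bij_betwE by blast
    have "{a \<in> A.S - A.D. (a *v w, A.\<gamma> a) = (fst p, snd p)} \<approx> (UNIV :: 'a set)"
      using p by (intro A.fibre_eqpoll [OF inf]) auto
    moreover have "{b \<in> B.S - B.D. (b *v w', B.\<gamma> b) = (fst (k p), snd (k p))} \<approx> (UNIV :: 'a set)"
      using kp by (intro B.fibre_eqpoll [OF inf]) auto
    ultimately show ?thesis
      unfolding prod.collapse by (rule eqpoll_trans [OF _ eqpoll_sym])
  qed
  have "(\<lambda>a. (a *v w, A.\<gamma> a)) ` (A.S - A.D) \<subseteq> A.U \<times> A.\<Gamma>"
    using A.mult_w_in_U A.w A.\<gamma>_in_\<Gamma> by auto
  moreover have "(\<lambda>a. (a *v w', B.\<gamma> a)) ` (B.S - B.D) \<subseteq> B.U \<times> B.\<Gamma>"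
    using B.mult_w_in_U B.w B.\<gamma>_in_\<Gamma> by auto
  ultimately obtain F where F: "bij_betw F (A.S - A.D) (B.S - B.D)"
    "\<And>a. a \<in> A.S - A.D \<Longrightarrow> (F a *v w', B.\<gamma> (F a)) = k (a *v w, A.\<gamma> a)"
    using fibrewise_bijection [OF k _ _ fib] by blast
  define f where "f a = (if a \<in> A.D then G a else F a)" for a
  have "bij_betw f (A.D \<union> (A.S - A.D)) (B.D \<union> (B.S - B.D))"
    unfolding f_def using bij_betw_disjoint_Un [OF GD F(1)] by blast
  then have bij: "bij_betw f A.S B.S"
    using A.D_subset_S B.D_subset_S by (simp add: Un_absorb1)
  have f: "f a *v w' = g (a *v w)" "B.\<gamma> (f a) = h (A.\<gamma> a)" if "a \<in> A.S" for a
  proof -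
    have "f a *v w' = g (a *v w) \<and> B.\<gamma> (f a) = h (A.\<gamma> a)"
    proof (cases "a \<in> A.D")
      \<comment> \<open>Elements of \<open>D\<close> have both invariants zero on either side, and
        \<open>g\<close> and \<open>h\<close> fix zero.\<close>
      case True
      then have "f a \<in> B.D"
        using GD bij_betwE by (auto simp: f_def)
      then show ?thesis
        using A.D_zero [OF True] B.D_zero zero by simp
    next
      case False
      then show ?thesis
        using F(2) [of a] that by (simp add: f_def k_def)
    qed
    then show "f a *v w' = g (a *v w)" "B.\<gamma> (f a) = h (A.\<gamma> a)"
      by simp_all
  qed
  have mult: "f (a ** b) = f a ** f b" if ab: "a \<in> A.S" "b \<in> A.S" for a b
  proof -
    have in_sets: "a *v w \<in> A.U" "A.\<gamma> b \<in> A.\<Gamma>"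
      using A.mult_w_in_U A.w A.\<gamma>_in_\<Gamma> ab by auto
    then have "outer (a *v w) (A.\<gamma> b) \<in> A.D"
      by (auto simp: A.D_def)
    then have "f (a ** b) = outer (g (a *v w)) (h (A.\<gamma> b))"
      using G in_sets by (simp add: A.product_eq_outer [OF ab] f_def)
    also have "\<dots> = f a ** f b"
      using bij ab by (subst B.product_eq_outer) (auto simp: f bij_betw_apply)
    finally show ?thesis .
  qed
  have "flag_iso V V' 3 f"
    using bij mult by unfold_locales
  then show ?thesis
    by blast
qed

section \<open>Signatures\<close>

context flag
begin

lemma dim_V_add: "i \<le> j \<Longrightarrow> j \<le> r \<Longrightarrow> vec.dim (V i) + (j - i) \<le> vec.dim (V j)"
proof (induction j)
  case (Suc j)
  show ?case
  proof (cases "i = Suc j")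
    case False
    have "vec.dim (V j) < vec.dim (V (Suc j))"
      using Suc.prems V_step [of j] subspace_V [of j] subspace_V [of "Suc j"]
      by (intro vec.dim_psubset) (simp add: vec.span_eq_iff [THEN iffD2])
    then show ?thesis
      using Suc False by simp
  qed simp
qed simp

lemma dim_V_0: "vec.dim (V 0) = 0"
  by (simp add: V_0)

lemma dim_V_r: "vec.dim (V r) = CARD('n)"
  by (simp add: V_r vec_dim_card del: vec.dim_UNIV)

definition signature :: "nat list" where
  "signature = map (\<lambda>i. vec.dim (V (Suc i)) - vec.dim (V i)) [0..<r]"

text \<open>The exceptional signatures in terms of dimensions; the first conjunct forces
  \<open>r = 3\<close>.\<close>

definition k1l :: bool where
  "k1l \<longleftrightarrow> vec.dim M = Suc (vec.dim U) \<and> 2 \<le> vec.dim U \<and> vec.dim M + 2 \<le> CARD('n)"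

lemma dim_U_less_dim_M: "vec.dim U < vec.dim M"
  using dim_V_add [of 1 "r - 1"] r_gt_2 unfolding U_def M_def by linarith

lemma dim_M_less: "vec.dim M < CARD('n)"
  using dim_V_add [of "r - 1" r] r_gt_2 by (simp add: dim_V_r M_def)

lemma r_eq_3: "vec.dim M = Suc (vec.dim U) \<Longrightarrow> r = 3"
  using dim_V_add [of 1 "r - 1"] r_gt_2 unfolding U_def M_def by linarith

lemma k1l_iff: "(\<exists>k l. k > 1 \<and> l > 1 \<and> signature = [k, 1, l]) \<longleftrightarrow> k1l"
proof
  assume "\<exists>k l. k > 1 \<and> l > 1 \<and> signature = [k, 1, l]"
  then obtain k l where kl: "k > 1" "l > 1" "signature = [k, 1, l]"
    by blast
  then have "length signature = 3"
    by simp
  then have r: "r = 3"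
    by (simp add: signature_def)
  have "U = V 1" "M = V 2"
    unfolding U_def M_def by (simp_all add: r)
  moreover have "vec.dim (V 3) = CARD('n)"
    using dim_V_r r by simp
  moreover have "signature = [vec.dim (V 1) - vec.dim (V 0), vec.dim (V 2) - vec.dim (V 1), vec.dim (V 3) - vec.dim (V 2)]"
    unfolding signature_def by (simp add: r numeral_3_eq_3 numeral_2_eq_2)
  ultimately show k1l
    using kl dim_V_0 dim_U_less_dim_M unfolding k1l_def by (simp del: vec.dim_eq_0) linarith
next
  assume *: k1l
  then have r: "r = 3"
    using r_eq_3 by (simp add: k1l_def)
  have "U = V 1" "M = V 2"
    unfolding U_def M_def by (simp_all add: r)
  moreover have "vec.dim (V 3) = CARD('n)"
    using dim_V_r r by simp
  moreover have "signature = [vec.dim (V 1) - vec.dim (V 0), vec.dim (V 2) - vec.dim (V 1), vec.dim (V 3) - vec.dim (V 2)]"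
    unfolding signature_def by (simp add: r numeral_3_eq_3 numeral_2_eq_2)
  ultimately show "\<exists>k l. k > 1 \<and> l > 1 \<and> signature = [k, 1, l]"
    using * dim_V_0 unfolding k1l_def by (simp del: vec.dim_eq_0) linarith
qed

end

text \<open>The dimensions are the partial sums of the signature, starting from
  \<open>vec.dim (V 0) = 0\<close>.\<close>

lemma signature_eq_iff:
  assumes "flag V r" "flag V' r"
  shows "flag.signature V r = flag.signature V' r \<longleftrightarrow> (\<forall>i\<le>r. vec.dim (V i) = vec.dim (V' i))"
proof -
  interpret A: flag V r by fact
  interpret B: flag V' r by fact
  have "vec.dim (V i) = vec.dim (V' i)" if eq: "A.signature = B.signature" and "i \<le> r" for i
    using that(2)
  proof (induction i)
    case 0
    then show ?case
      by (simp add: A.dim_V_0 B.dim_V_0)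
  next
    case (Suc i)
    have "vec.dim (V (Suc i)) - vec.dim (V i) = vec.dim (V' (Suc i)) - vec.dim (V' i)"
      using arg_cong [OF eq, of "\<lambda>l. l ! i"] Suc.prems by (simp add: A.signature_def B.signature_def)
    then show ?case
      using Suc A.dim_V_add [of i "Suc i"] B.dim_V_add [of i "Suc i"] by simp
  qed
  moreover have "A.signature = B.signature" if "\<forall>i\<le>r. vec.dim (V i) = vec.dim (V' i)"
    unfolding A.signature_def B.signature_def by (rule map_cong) (use that in auto)
  ultimately show ?thesis
    by blast
qed

context flag_iso
begin

lemma dim_V_eq:
  assumes "1 \<le> i" "i < r"
  shows "vec.dim (V i) + vec.dim B.U = vec.dim (V' i) + vec.dim A.U"
proof -
  interpret inv: flag_iso V' V r "inv_into A.S f"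
    by (rule inverse)
  show ?thesis
    using dim_V_le [OF assms] inv.dim_V_le [OF assms] by simp
qed

lemma dim_M_eq: "vec.dim A.M + vec.dim B.U = vec.dim B.M + vec.dim A.U"
  using dim_V_eq [of "r - 1"] A.r_gt_2 by (simp add: A.M_def B.M_def)

lemma all_products_iff:
  "(\<forall>x \<in> A.L \<inter> A.R. \<exists>a\<in>A.S. \<exists>b\<in>A.S. x = a ** b) \<longleftrightarrow>
   (\<forall>x \<in> B.L \<inter> B.R. \<exists>a\<in>B.S. \<exists>b\<in>B.S. x = a ** b)"
proof -
  interpret inv: flag_iso V' V r "inv_into A.S f"
    by (rule inverse)
  show ?thesis
    using all_products_transfer inv.all_products_transfer by blast
qed

text \<open>The difference of the dimensions of \<open>M\<close> and \<open>U\<close> is preserved.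
  When it is one, being of the exceptional form means that some element of
  \<open>L \<inter> R\<close> is no product.\<close>

lemma k1l_transfer: "A.k1l \<Longrightarrow> B.k1l"
  using all_products_iff A.all_products_iff B.all_products_iff dim_M_eq B.dim_U_pos B.dim_M_less
  unfolding A.k1l_def B.k1l_def by auto

text \<open>Over a finite field by counting; if \<open>M\<close> exceeds \<open>U\<close> by at
  least two dimensions, from the lattice of subspaces of \<open>U\<close>; in the remaining case the
  first or the last entry of the signature is 1.\<close>

lemma dim_U_eq:
  assumes "finite (UNIV :: 'a set) \<or> \<not> A.k1l"
  shows "vec.dim A.U = vec.dim B.U"
proof -
  interpret inv: flag_iso V' V r "inv_into A.S f"
    by (rule inverse)
  consider "finite (UNIV :: 'a set)" | "vec.dim A.U + 2 \<le> vec.dim A.M"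
    | "vec.dim A.M = Suc (vec.dim A.U)" "\<not> A.k1l"
    using assms A.dim_U_less_dim_M by linarith
  then show ?thesis
  proof cases
    case 1
    have "card A.U = card B.U"
      using card_U_le [OF 1] inv.card_U_le [OF 1] by simp
    then show ?thesis
      using card_subspace_less [OF 1 A.subspace_U B.subspace_U]
        card_subspace_less [OF 1 B.subspace_U A.subspace_U] by (metis linorder_neqE_nat less_irrefl)
  next
    case 2
    moreover from this have "vec.dim B.U + 2 \<le> vec.dim B.M"
      using dim_M_eq by linarith
    ultimately show ?thesis
      using dim_U_le inv.dim_U_le by simp
  next
    case 3
    then have BM: "vec.dim B.M = Suc (vec.dim B.U)"
      using dim_M_eq by linarith
    \<comment> \<open>If neither \<open>U\<close> is a line, then both dimensions of
      \<open>U\<close> equal \<open>CARD('n) - 2\<close>; being a line is itself preserved.\<close>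
    have "vec.dim A.U = 1 \<or> vec.dim A.M + 1 = CARD('n)"
      using 3 A.dim_U_pos A.dim_M_less unfolding A.k1l_def by linarith
    then have "vec.dim B.U = 1 \<or> vec.dim B.M + 1 = CARD('n)"
      using all_products_iff A.all_products_iff [OF 3(1)] B.all_products_iff [OF BM] by simp
    then show ?thesis
      using \<open>vec.dim A.U = 1 \<or> _\<close> dim_U_eq_1_transfer inv.dim_U_eq_1_transfer 3(1) BM by linarith
  qed
qed

lemma signature_eq:
  assumes "finite (UNIV :: 'a set) \<or> \<not> A.k1l"
  shows "A.signature = B.signature"
proof -
  have "vec.dim (V i) = vec.dim (V' i)" if "i \<le> r" for i
  proof -
    from that consider "i = 0" | "i = r" | "1 \<le> i" "i < r"
      by linarith
    then show ?thesis
      using dim_V_eq dim_U_eq [OF assms]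
      by cases (auto simp: A.dim_V_0 B.dim_V_0 A.dim_V_r B.dim_V_r)
  qed
  then show ?thesis
    using signature_eq_iff [OF A.flag_axioms B.flag_axioms] by blast
qed

end

lemma flag_iso_iff_signature:
  fixes V V' :: "nat \<Rightarrow> ('a::field ^ 'n) set"
  assumes "flag V r" "flag V' r" "finite (UNIV :: 'a set) \<or> \<not> flag.k1l V r"
  shows "(\<exists>f. flag_iso V V' r f) \<longleftrightarrow> flag.signature V r = flag.signature V' r"
  using flag_iso.signature_eq conjugate_flag_iso [OF assms(1,2)] signature_eq_iff [OF assms(1,2)] assms(3)
  by blast

lemma flag_iso_iff_k1l:
  fixes V V' :: "nat \<Rightarrow> ('a::field ^ 'n) set"
  assumes "flag V r" "flag V' r" "infinite (UNIV :: 'a set)" "flag.k1l V r"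
  shows "(\<exists>f. flag_iso V V' r f) \<longleftrightarrow> flag.k1l V' r"
proof
  have locale_k1l: "\<exists>w \<eta>. flag_k1l W w \<eta>"
    if "flag W r" and "flag.k1l W r" and r: "r = 3" for W :: "nat \<Rightarrow> ('a ^ 'n) set"
  proof -
    interpret flag W 3
      using that by simp
    obtain \<eta> w where \<eta>: "\<And>u. u \<in> U \<Longrightarrow> dotp \<eta> u = 0" "w \<in> M" "dotp \<eta> w = 1"
      using functional_on_U by blast
    have "flag_k1l W w \<eta>"
      by unfold_locales (use \<eta> that(2) r in \<open>auto simp: k1l_def\<close>)
    then show ?thesis
      by blast
  qed
  assume "flag.k1l V' r"
  moreover have "r = 3"
    using flag.r_eq_3 [OF assms(1)] assms(1,4) flag.k1l_def by blast
  ultimately show "\<exists>f. flag_iso V V' r f"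
    using locale_k1l assms flag_iso_k1l by metis
qed (use assms flag_iso.k1l_transfer in blast)

section \<open>From lists of subspaces to indexed flags, and the classification\<close>

lemma flag_of_is_flag:
  assumes "is_flag F" "flag_length F = r" "r > 2"
  shows "flag ((!) F) r"
proof
  have len: "length F = Suc r"
    using assms by (simp add: flag_length_def)
  have F: "F \<noteq> []" "hd F = {0}" "last F = UNIV" "\<And>V. V \<in> set F \<Longrightarrow> vec.subspace V"
    "\<And>i. Suc i < length F \<Longrightarrow> F ! i \<subset> F ! Suc i"
    using assms(1) by (auto simp: is_flag_def)
  show "2 < r" by fact
  show "F ! 0 = {0}" "F ! r = UNIV"
    using F(1-3) len by (simp_all add: hd_conv_nth last_conv_nth)
  show "vec.subspace (F ! i)" if "i \<le> r" for i
    using F(4) len that by simp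
  show "F ! i \<subset> F ! Suc i" if "i < r" for i
    using F(5) len that by simp
qed

theorem theorem13:
  fixes F F' :: "('a::field ^ 'n) set list" and r :: nat
  assumes "is_flag F" and "is_flag F'"
    and "flag_length F = r" and "flag_length F' = r" and "r > 2"
  shows "(infinite (UNIV :: 'a set) \<longrightarrow> (\<exists>k l. k > 1 \<and> l > 1 \<and> flag_sig F = [k, 1, l]) \<longrightarrow>
            (semigroup_iso (flag_phi F) (flag_phi F') \<longleftrightarrow>
              (\<exists>k' l'. k' > 1 \<and> l' > 1 \<and> flag_sig F' = [k', 1, l'])))
       \<and> (infinite (UNIV :: 'a set) \<longrightarrow> \<not> (\<exists>k l. k > 1 \<and> l > 1 \<and> flag_sig F = [k, 1, l]) \<longrightarrow>
            (semigroup_iso (flag_phi F) (flag_phi F') \<longleftrightarrow> flag_sig F = flag_sig F'))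
       \<and> (finite (UNIV :: 'a set) \<longrightarrow>
            (semigroup_iso (flag_phi F) (flag_phi F') \<longleftrightarrow> flag_sig F = flag_sig F'))"
proof -
  interpret A: flag "(!) F" r
    using assms by (intro flag_of_is_flag)
  interpret B: flag "(!) F'" r
    using assms by (intro flag_of_is_flag)
  have len: "length F = Suc r" "length F' = Suc r"
    using assms by (simp_all add: flag_length_def)
  have sig: "flag_sig F = A.signature" "flag_sig F' = B.signature"
    by (simp_all add: flag_sig_def A.signature_def B.signature_def len)
  have phi: "flag_phi F = A.S" "flag_phi F' = B.S"
    by (auto simp: flag_phi_def A.S_def B.S_def len)
  \<comment> \<open>The locale \<open>flag_iso\<close> consists of the two flags, both given here,
    and exactly the defining property of a semigroup isomorphism.\<close>
  have iso: "semigroup_iso A.S B.S \<longleftrightarrow> (\<exists>f. flag_iso ((!) F) ((!) F') r f)"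
    unfolding semigroup_iso_def flag_iso_def flag_iso_axioms_def
    using A.flag_axioms B.flag_axioms by blast
  show ?thesis
    unfolding sig phi iso A.k1l_iff B.k1l_iff
    using flag_iso_iff_signature [OF A.flag_axioms B.flag_axioms]
      flag_iso_iff_k1l [OF A.flag_axioms B.flag_axioms] by blast
qed

end
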